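(* For every integer $d\ge2$, the polytope $\mathscr{B}_{K_{1,d-1}}\subset\mathbb{R}^d$ satisfies $$\deg(\mathscr{B}_{K_{1,d-1}})=d\cdot2^d\quad\text{and}\quad\mathrm{mldeg}(\mathscr{B}_{K_{1,d-1}})=2^d.$$
   Context: For a simple undirected graph $G$ on vertex set $\{1,\dots,d\}$ with edge set $E(G)$, $\mathscr{B}_G\subset\mathbb{R}^d$ is the convex hull of $\{0,\pm e_1,\dots,\pm e_d\}\cup\{\pm e_i\pm e_j\mid\{i,j\}\in E(G)\}$ (all sign combinations), where $e_1,\dots,e_d$ are the standard basis vectors. $K_{1,d-1}$ is the star with center $1$ and edges $\{1,j\}$, $j=2,\dots,d$. For a lattice polytope $P \subset \mathbb{R}^d$ with lattice points $P\cap\mathbb{Z}^d = \{a_1,\dots,a_n\}$, the design matrix is $A = [a_1\ \cdots\ a_n] \in \mathbb{Z}^{d\times n}$, and $A'$ is $A$ with an additional first row of ones. The toric variety $V = V_A\subseteq \mathbb{C}^n$ (standard scaling) is the Zariski closure of the image of $\psi:(\mathbb{C}^* )^{d+1}\to(\mathbb{C}^* )^n$, $(s,\theta)\mapsto (s\theta^{a_1},\dots,s\theta^{a_n})$. It is the affine cone over a projective toric variety; $\deg(P) := \deg(V)$ is its degree. For data $u\in\mathbb{N}^n$ with $u_+ = \sum_i u_i$, the score equations are $A'p = \frac{1}{u_+}A'u$ with $p\in V\cap(\mathbb{C}^* )^n$, and $\mathrm{mldeg}(P):=\mathrm{mldeg}(V)$ is the number of complex solutions $p$ for generic $u$. *)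

theory Defs
  imports "HOL-Analysis.Analysis" "HOL-Library.Poly_Mapping" "HOL-Computational_Algebra.Polynomial"
begin

section \<open>Graph polytopes and their lattice points\<close>

text \<open>A graph on the vertex set \<open>UNIV :: 'd set\<close> is given by its set of two-element edges.\<close>

definition star_edges :: "'d \<Rightarrow> 'd set set" where
  "star_edges c = {{c, j} | j. j \<noteq> c}"

definition graph_polytope :: "'d::finite set set \<Rightarrow> (real^'d) set" where
  "graph_polytope E = convex hull
     ({0} \<union> {s *\<^sub>R axis i 1 | s i. s \<in> {1, -1}}
      \<union> {s *\<^sub>R axis i 1 + t *\<^sub>R axis j 1 | s t i j. s \<in> {1, -1} \<and> t \<in> {1, -1} \<and> {i, j} \<in> E})"

definition lattice_points :: "(real^'d) set \<Rightarrow> (int^'d) set" where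
  "lattice_points P = {a. (\<chi> i. real_of_int (a $ i)) \<in> P}"


section \<open>Complex polynomials and Zariski closure\<close>

text \<open>Polynomials in variables \<open>x\<^sub>i\<close>, \<open>i :: 'i\<close>, as finitely supported maps from exponent vectors to
  coefficients. Affine space \<open>\<complex>\<^bsup>A\<^esup>\<close> for a finite index set \<open>A\<close> is \<open>A \<rightarrow>\<^sub>E UNIV\<close>; extensionality makes
  the number of points with a given property meaningful.\<close>

type_synonym 'i cpoly = "('i \<Rightarrow>\<^sub>0 nat) \<Rightarrow>\<^sub>0 complex"

definition poly_vars :: "'i cpoly \<Rightarrow> 'i set" where
  "poly_vars F = (\<Union>m\<in>Poly_Mapping.keys F. Poly_Mapping.keys m)"

definition poly_eval :: "'i cpoly \<Rightarrow> ('i \<Rightarrow> complex) \<Rightarrow> complex" where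
  "poly_eval F x = (\<Sum>m\<in>Poly_Mapping.keys F.
     Poly_Mapping.lookup F m * (\<Prod>i\<in>Poly_Mapping.keys m. x i ^ Poly_Mapping.lookup m i))"

definition poly_scale :: "complex \<Rightarrow> 'i cpoly \<Rightarrow> 'i cpoly" where
  "poly_scale c F = Poly_Mapping.map (\<lambda>z. c * z) F"

definition vanishing_ideal :: "'i set \<Rightarrow> ('i \<Rightarrow> complex) set \<Rightarrow> 'i cpoly set" where
  "vanishing_ideal A S = {F. poly_vars F \<subseteq> A \<and> (\<forall>x\<in>S. poly_eval F x = 0)}"

definition zariski_closure :: "'i set \<Rightarrow> ('i \<Rightarrow> complex) set \<Rightarrow> ('i \<Rightarrow> complex) set" where
  "zariski_closure A S = {x \<in> A \<rightarrow>\<^sub>E UNIV. \<forall>F\<in>vanishing_ideal A S. poly_eval F x = 0}"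


section \<open>Degree of an affine cone\<close>

definition homogeneous_polys :: "'i set \<Rightarrow> nat \<Rightarrow> 'i cpoly set" where
  "homogeneous_polys A k = {F. poly_vars F \<subseteq> A \<and>
     (\<forall>m\<in>Poly_Mapping.keys F. (\<Sum>i\<in>Poly_Mapping.keys m. Poly_Mapping.lookup m i) = k)}"

lemma lookup_poly_scale: "Poly_Mapping.lookup (poly_scale c F) m = c * Poly_Mapping.lookup F m"
  by (simp add: poly_scale_def Poly_Mapping.map.rep_eq when_def)

interpretation cpoly: vector_space "poly_scale :: complex \<Rightarrow> 'i cpoly \<Rightarrow> 'i cpoly"
  by unfold_locales
    (auto intro!: poly_mapping_eqI simp: lookup_poly_scale lookup_add algebra_simps)

text \<open>The dimension of the degree \<open>k\<close> part of the homogeneous coordinate ring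
  \<open>\<complex>[x\<^sub>a | a \<in> A] / I(V)\<close>.\<close>

definition hilbert_function :: "'i set \<Rightarrow> ('i \<Rightarrow> complex) set \<Rightarrow> nat \<Rightarrow> nat" where
  "hilbert_function A V k =
     cpoly.dim (homogeneous_polys A k) - cpoly.dim (homogeneous_polys A k \<inter> vanishing_ideal A V)"

text \<open>The degree of the projective variety \<open>\<P>(V)\<close> of dimension \<open>r\<close> is \<open>r!\<close> times the leading
  coefficient of its Hilbert polynomial, which has degree \<open>r\<close>.\<close>

definition has_cone_degree :: "'i set \<Rightarrow> ('i \<Rightarrow> complex) set \<Rightarrow> nat \<Rightarrow> bool" where
  "has_cone_degree A V e \<longleftrightarrow> (\<exists>h :: real poly.
     (\<forall>\<^sub>F k in sequentially. real (hilbert_function A V k) = poly h (real k)) \<and>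
     real e = fact (Polynomial.degree h) * lead_coeff h)"

text \<open>Here and in \<open>ml_degree\<close> below, the value 0 is used if the number is not well defined, so a
  nonzero value entails existence.\<close>

definition cone_degree :: "'i set \<Rightarrow> ('i \<Rightarrow> complex) set \<Rightarrow> nat" where
  "cone_degree A V = (if \<exists>!e. has_cone_degree A V e then THE e. has_cone_degree A V e else 0)"


section \<open>Toric varieties and maximum likelihood degree\<close>

text \<open>The coordinates of \<open>\<complex>\<^sup>n\<close> are indexed by the columns \<open>a \<in> A\<close> of the design matrix.\<close>

definition toric_param :: "(int^'d::finite) set \<Rightarrow> complex \<Rightarrow> complex^'d \<Rightarrow> int^'d \<Rightarrow> complex" where
  "toric_param A s \<theta> = (\<lambda>a\<in>A. s * (\<Prod>i\<in>UNIV. (\<theta> $ i) powi (a $ i)))"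

definition toric_variety :: "(int^'d::finite) set \<Rightarrow> (int^'d \<Rightarrow> complex) set" where
  "toric_variety A = zariski_closure A {toric_param A s \<theta> | s \<theta>. s \<noteq> 0 \<and> (\<forall>i. \<theta> $ i \<noteq> 0)}"

text \<open>The entry of the extended design matrix in column \<open>a\<close>: row \<open>None\<close> is the row of ones.\<close>

fun design_entry :: "'d option \<Rightarrow> int^'d \<Rightarrow> int" where
  "design_entry None a = 1"
| "design_entry (Some i) a = a $ i"

definition score_solutions ::
  "(int^'d::finite) set \<Rightarrow> (int^'d \<Rightarrow> complex) set \<Rightarrow> (int^'d \<Rightarrow> nat) \<Rightarrow> (int^'d \<Rightarrow> complex) set" where
  "score_solutions A V u = {p \<in> V. (\<forall>a\<in>A. p a \<noteq> 0) \<and>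
     (\<forall>r. (\<Sum>a\<in>A. of_int (design_entry r a) * p a) =
          1 / of_nat (\<Sum>a\<in>A. u a) * (\<Sum>a\<in>A. of_int (design_entry r a) * of_nat (u a)))}"

text \<open>Generic data are those outside the zero set of some nonzero polynomial.\<close>

definition has_ml_degree :: "(int^'d::finite) set \<Rightarrow> (int^'d \<Rightarrow> complex) set \<Rightarrow> nat \<Rightarrow> bool" where
  "has_ml_degree A V m \<longleftrightarrow> (\<exists>F. F \<noteq> 0 \<and> poly_vars F \<subseteq> A \<and>
     (\<forall>u :: int^'d \<Rightarrow> nat. poly_eval F (\<lambda>a. of_nat (u a)) \<noteq> 0 \<longrightarrow>
        finite (score_solutions A V u) \<and> card (score_solutions A V u) = m))"

definition ml_degree :: "(int^'d::finite) set \<Rightarrow> (int^'d \<Rightarrow> complex) set \<Rightarrow> nat" where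
  "ml_degree A V = (if \<exists>!m. has_ml_degree A V m then THE m. has_ml_degree A V m else 0)"

definition polytope_degree :: "(real^'d::finite) set \<Rightarrow> nat" where
  "polytope_degree P = cone_degree (lattice_points P) (toric_variety (lattice_points P))"

definition polytope_ml_degree :: "(real^'d::finite) set \<Rightarrow> nat" where
  "polytope_ml_degree P = ml_degree (lattice_points P) (toric_variety (lattice_points P))"

end

theory Submission
  imports Defs
begin

text \<open>
  The polytope is the product of the segment \<open>[-1, 1]\<close> in direction \<open>c\<close> and the cross polytope
  \<open>\<Sum>\<^bsub>j \<noteq> c\<^esub> |x\<^sub>j| \<le> 1\<close> in the other \<open>d - 1\<close> directions (\<open>lattice_points_star_polytope\<close>), and both
  invariants are computed through this splitting.

  Degree. Restricting forms of degree \<open>k\<close> to the torus turns the Hilbert function of a toric variety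
  into the number of points that are sums of \<open>k\<close> of its lattice points
  (\<open>hilbert_function_toric_variety\<close>). Here these sums are all lattice points of the \<open>k\<close>-th dilate
  (\<open>exponent_sum_monomials_prism\<close>), because a point of the dilate can be moved towards the origin
  one lattice point of the polytope at a time. Their number is
  \<open>(2k + 1) \<Sum>\<^sub>i 2\<^sup>i C(d-1, i) C(k, i)\<close>, a polynomial in \<open>k\<close> of degree \<open>d\<close> with leading coefficient
  \<open>2 2\<^bsup>d-1\<^esup> / (d-1)!\<close>; multiplying by \<open>d!\<close> gives \<open>d 2\<^sup>d\<close>.

  Maximum likelihood degree. The quadrics \<open>p\<^sub>a p\<^sub>b = p\<^bsub>a'\<^esub> p\<^bsub>b'\<^esub>\<close> for \<open>a + b = a' + b'\<close> show that points
  of the variety with nonzero coordinates lie in the image of the torus (\<open>prism_torus_points\<close>). The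
  Laurent polynomial \<open>\<Sum>\<^sub>a \<theta>\<^sup>a\<close> is a product \<open>f(\<theta>\<^sub>c) g(\<theta>)\<close>, so after elimination of the scaling \<open>s\<close> the
  score equations split into two systems of the same shape,
  \<open>\<theta>\<^sub>j - 1/\<theta>\<^sub>j = b\<^sub>j G\<close> for \<open>j \<in> J\<close>, where \<open>G = 1 + \<Sum>\<^bsub>j \<in> J\<^esub> (\<theta>\<^sub>j + 1/\<theta>\<^sub>j)\<close>,
  one for \<open>J = {c}\<close> and one for the complement; \<open>b\<close> is the average of the lattice points
  weighted by the data. If all data are positive, which is a generic condition, then
  \<open>\<Sum>\<^bsub>j \<in> J\<^esub> |b\<^sub>j| < 1\<close>. This inequality makes the count elementary. It forces every complex solution
  to be real, as \<open>|Im (z + 1/z)| \<le> |Im (z - 1/z)|\<close> (\<open>cross_critical_real\<close>). Moreover, for prescribed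
  signs of the \<open>\<theta>\<^sub>j\<close>, the value \<open>G\<close> is a fixed point of a contraction of the real line with constant
  \<open>\<Sum>\<^bsub>j \<in> J\<^esub> |b\<^sub>j|\<close>, so each sign pattern belongs to exactly one solution (\<open>cross_critical_unique\<close>,
  \<open>cross_critical_exists\<close>). Altogether there are \<open>2\<^sup>d\<close> sign patterns.
\<close>

section \<open>Evaluating polynomials given by exponent maps\<close>

definition monom_value :: "('i \<Rightarrow> complex) \<Rightarrow> ('i \<Rightarrow>\<^sub>0 nat) \<Rightarrow> complex" where
  "monom_value x m = (\<Prod>i\<in>Poly_Mapping.keys m. x i ^ Poly_Mapping.lookup m i)"

lemma monom_value_superset:
  assumes "finite I" and "Poly_Mapping.keys m \<subseteq> I"
  shows "monom_value x m = (\<Prod>i\<in>I. x i ^ Poly_Mapping.lookup m i)"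
  unfolding monom_value_def
  by (rule prod.mono_neutral_left) (use assms in \<open>auto simp: in_keys_iff\<close>)

lemma monom_value_add: "monom_value x (m + m') = monom_value x m * monom_value x m'"
proof -
  define I where "I = Poly_Mapping.keys m \<union> Poly_Mapping.keys m'"
  have "finite I" "Poly_Mapping.keys m \<subseteq> I" "Poly_Mapping.keys m' \<subseteq> I"
    "Poly_Mapping.keys (m + m') \<subseteq> I"
    using keys_add[of m m'] by (auto simp: I_def)
  then show ?thesis
    by (simp add: monom_value_superset[of I] lookup_add power_add prod.distrib)
qed

lemma monom_value_single: "monom_value x (Poly_Mapping.single i n) = x i ^ n"
  by (subst monom_value_superset[of "{i}"]) (auto simp: lookup_single)

lemma poly_eval_superset:
  assumes "finite M" and "Poly_Mapping.keys F \<subseteq> M"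
  shows "poly_eval F x = (\<Sum>m\<in>M. Poly_Mapping.lookup F m * monom_value x m)"
  unfolding poly_eval_def monom_value_def
  by (rule sum.mono_neutral_left) (use assms in \<open>auto simp: in_keys_iff\<close>)

lemma poly_eval_monomial: "poly_eval (Poly_Mapping.single m 1) x = monom_value x m"
  by (subst poly_eval_superset[of "{m}"]) (auto simp: lookup_single)

lemma poly_eval_diff: "poly_eval (F - G) x = poly_eval F x - poly_eval G x"
proof -
  define M where "M = Poly_Mapping.keys F \<union> Poly_Mapping.keys G"
  have "finite M" "Poly_Mapping.keys F \<subseteq> M" "Poly_Mapping.keys G \<subseteq> M"
    "Poly_Mapping.keys (F - G) \<subseteq> M"
    by (auto simp: M_def in_keys_iff lookup_minus)
  then show ?thesis
    by (simp add: poly_eval_superset[of M] lookup_minus algebra_simps sum_subtractf)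
qed

lemma vanishing_ideal_zariski_closure:
  assumes "S \<subseteq> A \<rightarrow>\<^sub>E UNIV"
  shows "vanishing_ideal A (zariski_closure A S) = vanishing_ideal A S"
  using assms unfolding vanishing_ideal_def zariski_closure_def by blast

lemma subset_zariski_closure:
  assumes "S \<subseteq> A \<rightarrow>\<^sub>E UNIV"
  shows "S \<subseteq> zariski_closure A S"
  using assms unfolding vanishing_ideal_def zariski_closure_def by blast


section \<open>Distinct Laurent monomials are independent on positive integer points\<close>

text \<open>Reading a vector \<open>v\<close> as the coefficients of a univariate polynomial \<open>\<Sum> v\<^sub>i X\<^bsup>idx i\<^esup>\<close>, some
  natural number \<open>N\<close> is a root of none of finitely many nonzero ones; the powers of \<open>N\<close> are the
  wanted weights.\<close>

lemma separating_weight: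
  fixes V :: "('i \<Rightarrow> int) set"
  assumes I: "finite I" and V: "finite V" and nz: "\<And>v. v \<in> V \<Longrightarrow> \<exists>i\<in>I. v i \<noteq> 0"
  obtains e :: "'i \<Rightarrow> nat" where "\<And>v. v \<in> V \<Longrightarrow> (\<Sum>i\<in>I. int (e i) * v i) \<noteq> 0"
proof -
  obtain idx :: "'i \<Rightarrow> nat" where idx: "inj_on idx I"
    using finite_imp_inj_to_nat_seg[OF I] by blast
  define p where "p v = (\<Sum>i\<in>I. monom (v i) (idx i))" for v :: "'i \<Rightarrow> int"
  have p_nz: "p v \<noteq> 0" if v: "v \<in> V" for v
  proof -
    obtain i where i: "i \<in> I" "v i \<noteq> 0" using nz[OF v] by blast
    have "poly.coeff (p v) (idx i) = (\<Sum>j\<in>I. if j = i then v j else 0)"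
      unfolding p_def coeff_sum using idx i(1)
      by (intro sum.cong) (auto dest: inj_onD)
    with i I have "poly.coeff (p v) (idx i) \<noteq> 0" by simp
    then show ?thesis by auto
  qed
  have "(\<Prod>v\<in>V. p v) \<noteq> 0" using V p_nz by simp
  then have "finite {x. poly (\<Prod>v\<in>V. p v) x = 0}" by (rule poly_roots_finite)
  moreover have "infinite (range int)" by (simp add: finite_image_iff)
  ultimately obtain N :: nat where N: "poly (\<Prod>v\<in>V. p v) (int N) \<noteq> 0"
    by (metis (mono_tags, lifting) finite_subset image_subsetI mem_Collect_eq)
  show thesis
  proof (rule that[of "\<lambda>i. N ^ idx i"])
    fix v assume "v \<in> V"
    with N V have "poly (p v) (int N) \<noteq> 0" by (auto simp: poly_prod)
    then show "(\<Sum>i\<in>I. int (N ^ idx i) * v i) \<noteq> 0"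
      by (simp add: p_def poly_sum poly_monom mult.commute)
  qed
qed

lemma prod_power_int:
  fixes t :: "'a::field"
  assumes "t \<noteq> 0"
  shows "(\<Prod>i\<in>I. t powi f i) = t powi (\<Sum>i\<in>I. f i)"
  by (induction I rule: infinite_finite_induct) (use assms in \<open>auto simp: power_int_add\<close>)

text \<open>Along the curve \<open>u\<^sub>i = t\<^bsup>e i\<^esup>\<close> with separating weights \<open>e\<close>, distinct Laurent monomials become
  distinct powers of \<open>t\<close>, so the univariate theory applies.\<close>

lemma laurent_sum_nonzero:
  fixes ex :: "'k \<Rightarrow> 'i \<Rightarrow> int" and C :: "'k \<Rightarrow> complex"
  assumes I: "finite I" and M: "finite M"
    and dist: "\<And>k l. k \<in> M \<Longrightarrow> l \<in> M \<Longrightarrow> k \<noteq> l \<Longrightarrow> \<exists>i\<in>I. ex k i \<noteq> ex l i"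
    and k0: "k0 \<in> M" "C k0 \<noteq> 0"
  obtains u :: "'i \<Rightarrow> nat" where "\<And>i. u i > 0"
    and "(\<Sum>k\<in>M. C k * (\<Prod>i\<in>I. of_nat (u i) powi ex k i)) \<noteq> 0"
proof -
  define V where "V = (\<lambda>(k, l) i. ex k i - ex l i) ` {(k, l) \<in> M \<times> M. k \<noteq> l}"
  have "finite V" unfolding V_def using M by (intro finite_imageI) (auto intro: finite_subset)
  moreover have "\<exists>i\<in>I. v i \<noteq> 0" if "v \<in> V" for v
    using that dist by (fastforce simp: V_def)
  ultimately obtain e :: "'i \<Rightarrow> nat"
    where e: "\<And>v. v \<in> V \<Longrightarrow> (\<Sum>i\<in>I. int (e i) * v i) \<noteq> 0"
    using separating_weight[OF I] by metis
  define f where "f k = (\<Sum>i\<in>I. int (e i) * ex k i)" for k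
  have f: "inj_on f M"
  proof (rule inj_onI, rule ccontr)
    fix k l assume *: "k \<in> M" "l \<in> M" "f k = f l" "k \<noteq> l"
    then have "(\<lambda>i. ex k i - ex l i) \<in> V" unfolding V_def
      by (intro image_eqI[of _ _ "(k, l)"]) auto
    from e[OF this] * show False
      by (simp add: f_def algebra_simps sum_subtractf)
  qed
  (* Shifting by a large exponent turns the univariate Laurent polynomial into a polynomial. *)
  define N where "N = (\<Sum>k\<in>M. nat \<bar>f k\<bar>)"
  define g where "g k = nat (f k + int N)" for k
  have gf: "int (g k) = f k + int N" if "k \<in> M" for k
  proof -
    have "nat \<bar>f k\<bar> \<le> N" unfolding N_def using M that by (intro member_le_sum) auto
    then show ?thesis by (simp add: g_def)
  qed
  have g: "inj_on g M"
    using f gf by (metis (no_types, lifting) add_right_cancel inj_on_def)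
  define q where "q = (\<Sum>k\<in>M. monom (C k) (g k))"
  have "poly.coeff q (g k0) = (\<Sum>k\<in>M. if k = k0 then C k else 0)"
    unfolding q_def coeff_sum using g k0(1) by (intro sum.cong) (auto dest: inj_onD)
  then have "q \<noteq> 0" using k0 M by auto
  then have "finite {x. poly q x = 0}" by (rule poly_roots_finite)
  moreover have "infinite ((of_nat \<circ> Suc) ` UNIV :: complex set)"
    by (subst finite_image_iff) (auto simp: inj_on_def)
  ultimately obtain t' :: nat where t': "poly q (of_nat (Suc t')) \<noteq> 0"
    by (metis (mono_tags, lifting) comp_apply finite_subset image_subsetI mem_Collect_eq)
  define t where "t = Suc t'"
  show thesis
  proof (rule that[of "\<lambda>i. t ^ e i"])
    have t0: "(of_nat t :: complex) \<noteq> 0" by (simp add: t_def del: of_nat_Suc)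
    have mono: "(\<Prod>i\<in>I. of_nat (t ^ e i) powi ex k i) = (of_nat t :: complex) powi f k" for k
    proof -
      have "of_nat (t ^ e i) powi ex k i = (of_nat t :: complex) powi (int (e i) * ex k i)" for i
        by (simp add: power_int_mult)
      then have "(\<Prod>i\<in>I. of_nat (t ^ e i) powi ex k i)
          = (\<Prod>i\<in>I. (of_nat t :: complex) powi (int (e i) * ex k i))"
        by (intro prod.cong) auto
      also have "\<dots> = of_nat t powi f k" unfolding f_def by (rule prod_power_int[OF t0])
      finally show ?thesis .
    qed
    have "of_nat t powi int N * (\<Sum>k\<in>M. C k * (\<Prod>i\<in>I. of_nat (t ^ e i) powi ex k i))
        = (\<Sum>k\<in>M. C k * (of_nat t :: complex) ^ g k)"
      unfolding mono sum_distrib_left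
    proof (rule sum.cong[OF refl])
      fix k assume "k \<in> M"
      then have "(of_nat t :: complex) ^ g k = of_nat t powi (f k + int N)"
        by (metis gf power_int_of_nat)
      then show "of_nat t powi int N * (C k * of_nat t powi f k) = C k * (of_nat t :: complex) ^ g k"
        using t0 by (simp add: power_int_add)
    qed
    also have "\<dots> = poly q (of_nat t)" by (simp add: q_def poly_sum poly_monom)
    finally show "(\<Sum>k\<in>M. C k * (\<Prod>i\<in>I. of_nat (t ^ e i) powi ex k i)) \<noteq> 0"
      using t' by (auto simp: t_def)
  qed (simp add: t_def)
qed

section \<open>The Hilbert function of a toric variety counts sums of lattice points\<close>

text \<open>The coefficients at the monomials in \<open>Y\<close> read off the scalars of a linear relation in the family
  \<open>v\<close>, which is therefore independent.\<close>

lemma cpoly_dim_dual_family: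
  fixes v :: "('i \<Rightarrow>\<^sub>0 nat) \<Rightarrow> 'i cpoly"
  assumes Y: "finite Y"
    and dual: "\<And>m n. m \<in> Y \<Longrightarrow> n \<in> Y \<Longrightarrow> Poly_Mapping.lookup (v m) n = (if m = n then 1 else 0)"
    and in_W: "v ` Y \<subseteq> W"
    and expand: "\<And>F. F \<in> W \<Longrightarrow> F = (\<Sum>m\<in>Y. poly_scale (Poly_Mapping.lookup F m) (v m))"
  shows "cpoly.dim W = card Y"
proof (rule cpoly.dim_unique[OF in_W])
  have inj: "inj_on v Y"
  proof (rule inj_onI)
    fix m n assume "m \<in> Y" "n \<in> Y" "v m = v n"
    then show "m = n" using dual[of m n] dual[of n n] by (auto split: if_splits)
  qed
  then show "card (v ` Y) = card Y" by (rule card_image)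
  show "W \<subseteq> cpoly.span (v ` Y)"
  proof
    fix F assume "F \<in> W"
    have "(\<Sum>m\<in>Y. poly_scale (Poly_Mapping.lookup F m) (v m)) \<in> cpoly.span (v ` Y)"
      by (intro cpoly.span_sum cpoly.span_scale cpoly.span_base imageI)
    then show "F \<in> cpoly.span (v ` Y)" using expand[OF \<open>F \<in> W\<close>] by simp
  qed
  show "cpoly.independent (v ` Y)"
  proof (rule cpoly.independent_if_scalars_zero)
    fix u x assume sum0: "(\<Sum>x\<in>v ` Y. poly_scale (u x) x) = 0" and "x \<in> v ` Y"
    then obtain n where n: "n \<in> Y" "x = v n" by blast
    from sum0 have "(\<Sum>m\<in>Y. poly_scale (u (v m)) (v m)) = 0" by (simp add: sum.reindex[OF inj])
    then have "0 = Poly_Mapping.lookup (\<Sum>m\<in>Y. poly_scale (u (v m)) (v m)) n" by simp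
    also have "\<dots> = (\<Sum>m\<in>Y. if m = n then u (v m) else 0)"
      unfolding lookup_sum lookup_poly_scale using dual n(1) by (intro sum.cong) auto
    finally show "u x = 0" using Y n by simp
  qed (use Y in simp)
qed

lemma cpoly_dim_support:
  assumes "finite X"
  shows "cpoly.dim {F :: 'i cpoly. Poly_Mapping.keys F \<subseteq> X} = card X"
proof (rule cpoly_dim_dual_family[OF assms, of "\<lambda>m. Poly_Mapping.single m 1"])
  fix F :: "'i cpoly" assume F: "F \<in> {F. Poly_Mapping.keys F \<subseteq> X}"
  show "F = (\<Sum>m\<in>X. poly_scale (Poly_Mapping.lookup F m) (Poly_Mapping.single m 1))"
  proof (rule poly_mapping_eqI)
    fix n
    have "(\<Sum>m\<in>X. Poly_Mapping.lookup F m * Poly_Mapping.lookup (Poly_Mapping.single m 1) n)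
        = (\<Sum>m\<in>X. if m = n then Poly_Mapping.lookup F n else 0)"
      by (intro sum.cong) (auto simp: lookup_single)
    then show "Poly_Mapping.lookup F n = Poly_Mapping.lookup
        (\<Sum>m\<in>X. poly_scale (Poly_Mapping.lookup F m) (Poly_Mapping.single m 1)) n"
      using F assms by (auto simp: lookup_sum lookup_poly_scale in_keys_iff)
  qed
qed (auto simp: lookup_single)

text \<open>With a representative \<open>r b\<close> of every nonempty fiber, the differences \<open>x\<^sup>m - x\<^bsup>r (f m)\<^esup>\<close> for
  the non-representatives \<open>m\<close> form a basis.\<close>

lemma cpoly_dim_zero_fiber_sums:
  fixes f :: "('i \<Rightarrow>\<^sub>0 nat) \<Rightarrow> 'b"
  assumes X: "finite X"
  shows "cpoly.dim {F. Poly_Mapping.keys F \<subseteq> X \<and>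
      (\<forall>b. (\<Sum>m | m \<in> X \<and> f m = b. Poly_Mapping.lookup F m) = 0)} = card X - card (f ` X)"
    (is "cpoly.dim ?W = _")
proof -
  define r where "r = inv_into X f"
  have r: "r (f m) \<in> X" "f (r (f m)) = f m" if "m \<in> X" for m
    using that by (auto simp: r_def inv_into_into f_inv_into_f)
  define R where "R = r ` f ` X"
  have "card R = card (f ` X)" unfolding R_def r_def by (intro card_image inj_on_inv_into) simp
  moreover have RX: "R \<subseteq> X" using r by (auto simp: R_def)
  ultimately have card: "card (X - R) = card X - card (f ` X)"
    using X by (simp add: card_Diff_subset finite_subset)
  have R_fix: "r (f n) = n" if "n \<in> R" for n using that r(2) by (auto simp: R_def)
  have R_eq: "r (f m) = n \<longleftrightarrow> f m = f n" if "m \<in> X" "n \<in> R" for m n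
    using r(2)[OF that(1)] R_fix[OF that(2)] by metis
  define v :: "('i \<Rightarrow>\<^sub>0 nat) \<Rightarrow> 'i cpoly"
    where "v m = Poly_Mapping.single m 1 - Poly_Mapping.single (r (f m)) 1" for m
  have lookup_v: "Poly_Mapping.lookup (v m) n = (if m = n then 1 else 0) - (if r (f m) = n then 1 else 0)"
    for m n by (simp add: v_def lookup_minus lookup_single when_def)
  have "cpoly.dim ?W = card (X - R)"
  proof (rule cpoly_dim_dual_family[of _ v])
    show "finite (X - R)" using X by simp
    show "Poly_Mapping.lookup (v m) n = (if m = n then 1 else 0)" if "m \<in> X - R" "n \<in> X - R" for m n
      using that by (auto simp: lookup_v R_def)
    show "v ` (X - R) \<subseteq> ?W"
    proof safe
      fix m assume m: "m \<in> X"
      show "n \<in> X" if "n \<in> Poly_Mapping.keys (v m)" for n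
        using that m r by (auto simp: in_keys_iff lookup_v split: if_splits)
      fix b
      have "finite {n. n \<in> X \<and> f n = b}" using X by simp
      then show "(\<Sum>n | n \<in> X \<and> f n = b. Poly_Mapping.lookup (v m) n) = 0"
        using m r by (simp add: lookup_v sum_subtractf)
    qed
    fix F assume F: "F \<in> ?W"
    show "F = (\<Sum>m\<in>X - R. poly_scale (Poly_Mapping.lookup F m) (v m))"
    proof (rule poly_mapping_eqI)
      fix n
      have "Poly_Mapping.lookup (\<Sum>m\<in>X - R. poly_scale (Poly_Mapping.lookup F m) (v m)) n
          = (\<Sum>m\<in>X - R. if m = n then Poly_Mapping.lookup F n else 0)
          - (\<Sum>m\<in>X - R. if r (f m) = n then Poly_Mapping.lookup F m else 0)"
        unfolding lookup_sum lookup_poly_scale lookup_v sum_subtractf[symmetric]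
        by (intro sum.cong) auto
      also have "\<dots> = Poly_Mapping.lookup F n"
      proof (cases "n \<in> R")
        case False
        then have "(\<Sum>m\<in>X - R. if r (f m) = n then Poly_Mapping.lookup F m else 0) = 0"
          by (intro sum.neutral) (auto simp: R_def)
        then show ?thesis using X F False by (auto simp: in_keys_iff)
      next
        case True
        have "{m. m \<in> X \<and> f m = f n} = insert n {m \<in> X - R. f m = f n}"
        proof (intro equalityI subsetI)
          fix m assume m: "m \<in> {m. m \<in> X \<and> f m = f n}"
          then have "f m = f n" by blast
          then have "m = n" if "m \<in> R" using R_fix[OF that] R_fix[OF True] by metis
          then show "m \<in> insert n {m \<in> X - R. f m = f n}" using m by blast
        qed (use True RX in auto)
        moreover have "(\<Sum>m | m \<in> X \<and> f m = f n. Poly_Mapping.lookup F m) = 0" using F by blast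
        ultimately have "(\<Sum>m\<in>insert n {m \<in> X - R. f m = f n}. Poly_Mapping.lookup F m) = 0"
          by simp
        then have "Poly_Mapping.lookup F n
            + (\<Sum>m\<in>{m \<in> X - R. f m = f n}. Poly_Mapping.lookup F m) = 0"
          using X True by (subst (asm) sum.insert) auto
        moreover have "(\<Sum>m\<in>{m \<in> X - R. f m = f n}. Poly_Mapping.lookup F m)
            = (\<Sum>m\<in>X - R. if f m = f n then Poly_Mapping.lookup F m else 0)"
          using X by (intro sum.inter_filter) simp
        moreover have "(\<Sum>m\<in>X - R. if r (f m) = n then Poly_Mapping.lookup F m else 0)
            = (\<Sum>m\<in>X - R. if f m = f n then Poly_Mapping.lookup F m else 0)"
          using True by (intro sum.cong) (auto simp: R_eq)
        ultimately show ?thesis using X True by (simp add: add_eq_0_iff2)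
      qed
      finally show "Poly_Mapping.lookup F n = Poly_Mapping.lookup
          (\<Sum>m\<in>X - R. poly_scale (Poly_Mapping.lookup F m) (v m)) n" ..
    qed
  qed
  with card show ?thesis by simp
qed

definition total_degree :: "('i \<Rightarrow>\<^sub>0 nat) \<Rightarrow> nat" where
  "total_degree m = (\<Sum>i\<in>Poly_Mapping.keys m. Poly_Mapping.lookup m i)"

definition monomials_of_degree :: "'i set \<Rightarrow> nat \<Rightarrow> ('i \<Rightarrow>\<^sub>0 nat) set" where
  "monomials_of_degree A k = {m. Poly_Mapping.keys m \<subseteq> A \<and> total_degree m = k}"

definition exponent_sum :: "(int^'d \<Rightarrow>\<^sub>0 nat) \<Rightarrow> int^'d::finite" where
  "exponent_sum m = (\<chi> i. \<Sum>a\<in>Poly_Mapping.keys m. int (Poly_Mapping.lookup m a) * a $ i)"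

lemma finite_monomials_of_degree:
  assumes "finite A"
  shows "finite (monomials_of_degree A k)"
proof (rule finite_imageD)
  have "Poly_Mapping.lookup m a \<le> k" if "m \<in> monomials_of_degree A k" for m a
  proof (cases "a \<in> Poly_Mapping.keys m")
    case True
    then have "Poly_Mapping.lookup m a \<le> total_degree m"
      unfolding total_degree_def by (intro member_le_sum) auto
    with that show ?thesis by (simp add: monomials_of_degree_def)
  qed (simp add: in_keys_iff)
  then have "Poly_Mapping.lookup ` monomials_of_degree A k
      \<subseteq> {f. \<forall>x. (x \<in> A \<longrightarrow> f x \<in> {..k}) \<and> (x \<notin> A \<longrightarrow> f x = 0)}"
    by (auto simp: monomials_of_degree_def in_keys_iff)
  then show "finite (Poly_Mapping.lookup ` monomials_of_degree A k)"
    by (rule finite_subset) (intro finite_set_of_finite_funs assms finite_atMost)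
qed (auto intro: inj_onI poly_mapping_eqI)

lemma homogeneous_polys_eq:
  "homogeneous_polys A k = {F. Poly_Mapping.keys F \<subseteq> monomials_of_degree A k}"
  unfolding homogeneous_polys_def monomials_of_degree_def poly_vars_def total_degree_def by auto

lemma monom_value_toric_param:
  assumes "Poly_Mapping.keys m \<subseteq> A" and "\<And>i. \<theta> $ i \<noteq> 0"
  shows "monom_value (toric_param A s \<theta>) m
    = s ^ total_degree m * (\<Prod>i\<in>UNIV. (\<theta> $ i) powi (exponent_sum m $ i))"
proof -
  let ?K = "Poly_Mapping.keys m" and ?l = "Poly_Mapping.lookup m"
  have "monom_value (toric_param A s \<theta>) m = (\<Prod>a\<in>?K. (s * (\<Prod>i\<in>UNIV. (\<theta> $ i) powi (a $ i))) ^ ?l a)"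
    unfolding monom_value_def using assms(1) by (intro prod.cong) (auto simp: toric_param_def)
  also have "\<dots> = (\<Prod>a\<in>?K. s ^ ?l a) * (\<Prod>i\<in>UNIV. \<Prod>a\<in>?K. ((\<theta> $ i) powi (a $ i)) ^ ?l a)"
    by (simp add: power_mult_distrib prod.distrib prod_power_distrib prod.swap[of _ UNIV])
  also have "(\<lambda>i. \<Prod>a\<in>?K. ((\<theta> $ i) powi (a $ i)) ^ ?l a) = (\<lambda>i. (\<theta> $ i) powi (exponent_sum m $ i))"
  proof
    fix i
    have "(\<Prod>a\<in>?K. ((\<theta> $ i) powi (a $ i)) ^ ?l a) = (\<Prod>a\<in>?K. (\<theta> $ i) powi (int (?l a) * a $ i))"
      by (intro prod.cong refl) (metis mult.commute power_int_mult power_int_of_nat)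
    then show "(\<Prod>a\<in>?K. ((\<theta> $ i) powi (a $ i)) ^ ?l a) = (\<theta> $ i) powi (exponent_sum m $ i)"
      by (simp add: prod_power_int assms(2) exponent_sum_def)
  qed
  finally show ?thesis by (simp add: total_degree_def power_sum)
qed

text \<open>On the torus image, a form of degree \<open>k\<close> becomes \<open>s\<^sup>k\<close> times a Laurent polynomial whose
  coefficient at \<open>\<theta>\<^sup>b\<close> is the sum of the coefficients of all monomials with exponent sum \<open>b\<close>.
  Distinct Laurent monomials being independent, the forms in the ideal are those with vanishing
  fiber sums.\<close>

theorem hilbert_function_toric_variety:
  fixes A :: "(int^'d::finite) set"
  assumes A: "finite A"
  shows "hilbert_function A (toric_variety A) k = card (exponent_sum ` monomials_of_degree A k)"
proof -
  define S where "S = {toric_param A s \<theta> | s \<theta>. s \<noteq> 0 \<and> (\<forall>i. \<theta> $ i \<noteq> 0)}"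
  define X where "X = monomials_of_degree A k"
  define C where "C F b = (\<Sum>m | m \<in> X \<and> exponent_sum m = b. Poly_Mapping.lookup F m)"
    for F :: "(int^'d) cpoly" and b
  have X: "finite X" unfolding X_def by (rule finite_monomials_of_degree[OF A])
  have "S \<subseteq> A \<rightarrow>\<^sub>E UNIV" by (auto simp: S_def toric_param_def)
  then have I: "vanishing_ideal A (toric_variety A) = vanishing_ideal A S"
    unfolding toric_variety_def S_def by (rule vanishing_ideal_zariski_closure)
  have eval: "poly_eval F (toric_param A s \<theta>)
      = s ^ k * (\<Sum>b\<in>exponent_sum ` X. C F b * (\<Prod>i\<in>UNIV. (\<theta> $ i) powi (b $ i)))"
    if F: "Poly_Mapping.keys F \<subseteq> X" and nz: "\<And>i. \<theta> $ i \<noteq> 0" for F s \<theta>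
  proof -
    let ?g = "\<lambda>m. Poly_Mapping.lookup F m * (\<Prod>i\<in>UNIV. (\<theta> $ i) powi (exponent_sum m $ i))"
    have "poly_eval F (toric_param A s \<theta>) = (\<Sum>m\<in>X. s ^ k * ?g m)"
      unfolding poly_eval_superset[OF X F]
      using nz by (intro sum.cong) (auto simp: X_def monomials_of_degree_def monom_value_toric_param)
    also have "\<dots> = s ^ k * (\<Sum>b\<in>exponent_sum ` X. \<Sum>m | m \<in> X \<and> exponent_sum m = b. ?g m)"
      unfolding sum_distrib_left[symmetric] using sum.image_gen[OF X, of ?g exponent_sum] by simp
    also have "(\<lambda>b. \<Sum>m | m \<in> X \<and> exponent_sum m = b. ?g m)
        = (\<lambda>b. C F b * (\<Prod>i\<in>UNIV. (\<theta> $ i) powi (b $ i)))"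
      by (auto simp: C_def sum_distrib_right intro!: ext sum.cong)
    finally show ?thesis .
  qed
  have kernel: "homogeneous_polys A k \<inter> vanishing_ideal A (toric_variety A)
      = {F. Poly_Mapping.keys F \<subseteq> X \<and> (\<forall>b. C F b = 0)}"
  proof (intro equalityI subsetI)
    fix F assume F: "F \<in> homogeneous_polys A k \<inter> vanishing_ideal A (toric_variety A)"
    then have keys: "Poly_Mapping.keys F \<subseteq> X" by (simp add: homogeneous_polys_eq X_def)
    have "C F b = 0" for b
    proof (rule ccontr)
      assume b: "C F b \<noteq> 0"
      then obtain m where "m \<in> {m. m \<in> X \<and> exponent_sum m = b}"
        unfolding C_def by (rule sum.not_neutral_contains_not_neutral)
      then have "b \<in> exponent_sum ` X" by blast
      then obtain u :: "'d \<Rightarrow> nat" where u: "\<And>i. u i > 0" and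
        nz: "(\<Sum>b\<in>exponent_sum ` X. C F b * (\<Prod>i\<in>UNIV. of_nat (u i) powi (b $ i))) \<noteq> 0"
        using laurent_sum_nonzero[of "UNIV :: 'd set" "exponent_sum ` X" "\<lambda>b i. b $ i" b "C F"] X b
        by (auto simp: vec_eq_iff)
      define \<theta> :: "complex^'d" where "\<theta> = (\<chi> i. of_nat (u i))"
      have "\<theta> $ i \<noteq> 0" for i using u[of i] by (simp add: \<theta>_def)
      then have "toric_param A 1 \<theta> \<in> S" unfolding S_def by fastforce
      with F have "poly_eval F (toric_param A 1 \<theta>) = 0"
        unfolding I by (auto simp: vanishing_ideal_def)
      with eval[OF keys, of \<theta> 1] \<open>\<And>i. \<theta> $ i \<noteq> 0\<close> nz show False by (simp add: \<theta>_def)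
    qed
    with keys show "F \<in> {F. Poly_Mapping.keys F \<subseteq> X \<and> (\<forall>b. C F b = 0)}" by blast
  next
    fix F assume F: "F \<in> {F. Poly_Mapping.keys F \<subseteq> X \<and> (\<forall>b. C F b = 0)}"
    then have "poly_vars F \<subseteq> A" by (auto simp: poly_vars_def X_def monomials_of_degree_def)
    moreover have "poly_eval F x = 0" if "x \<in> S" for x
      using that F by (auto simp: S_def eval)
    ultimately show "F \<in> homogeneous_polys A k \<inter> vanishing_ideal A (toric_variety A)"
      using F unfolding I by (auto simp: vanishing_ideal_def homogeneous_polys_eq X_def)
  qed
  have "cpoly.dim (homogeneous_polys A k) = card X"
    unfolding homogeneous_polys_eq X_def[symmetric] by (rule cpoly_dim_support[OF X])
  moreover have "cpoly.dim (homogeneous_polys A k \<inter> vanishing_ideal A (toric_variety A))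
      = card X - card (exponent_sum ` X)"
    unfolding kernel C_def by (rule cpoly_dim_zero_fiber_sums[OF X])
  moreover have "card (exponent_sum ` X) \<le> card X" using X by (rule card_image_le)
  ultimately show ?thesis by (simp add: hilbert_function_def X_def)
qed

section \<open>Lattice points in dilated cross polytopes\<close>

definition cross_ball :: "'j set \<Rightarrow> nat \<Rightarrow> ('j \<Rightarrow> int) set" where
  "cross_ball J k = {f. (\<forall>j. j \<notin> J \<longrightarrow> f j = 0) \<and> (\<Sum>j\<in>J. \<bar>f j\<bar>) \<le> int k}"

lemma sum_symmetric_range:
  fixes g :: "nat \<Rightarrow> nat"
  shows "(\<Sum>t\<in>{- int k..int k}. g (k - nat \<bar>t\<bar>)) = g k + 2 * (\<Sum>j<k. g j)"
proof -
  have "{- int k..int k} = insert 0 ({1..int k} \<union> {- int k..-1})" by auto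
  then have "(\<Sum>t\<in>{- int k..int k}. g (k - nat \<bar>t\<bar>))
      = g k + ((\<Sum>t\<in>{1..int k}. g (k - nat \<bar>t\<bar>)) + (\<Sum>t\<in>{- int k..-1}. g (k - nat \<bar>t\<bar>)))"
    by (simp add: sum.union_disjoint)
  moreover have "(\<Sum>t\<in>{1..int k}. g (k - nat \<bar>t\<bar>)) = (\<Sum>j<k. g j)"
    by (rule sum.reindex_bij_witness[of _ "\<lambda>j. int k - int j" "\<lambda>t. k - nat t"]) auto
  moreover have "(\<Sum>t\<in>{- int k..-1}. g (k - nat \<bar>t\<bar>)) = (\<Sum>j<k. g j)"
    by (rule sum.reindex_bij_witness[of _ "\<lambda>j. int j - int k" "\<lambda>t. k - nat (- t)"]) auto
  ultimately show ?thesis by simp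
qed

lemma sum_choose_lessThan: "(\<Sum>j<k. j choose i) = k choose Suc i"
  by (induction k) auto

text \<open>Slicing along a new coordinate \<open>t\<close> leaves cross polytopes of size \<open>k - |t|\<close>; the resulting
  recursion is Pascal's rule together with the hockey-stick identity.\<close>

lemma card_cross_ball:
  assumes "finite J"
  shows "finite (cross_ball J k)"
    and "card (cross_ball J k) = (\<Sum>i\<le>card J. 2 ^ i * (card J choose i) * (k choose i))"
  using assms
proof (induction J arbitrary: k rule: finite_induct)
  case empty
  have eq: "cross_ball ({} :: 'a set) k = {\<lambda>_. 0}" for k by (auto simp: cross_ball_def)
  { case 1 then show ?case by (simp add: eq) }
  { case 2 then show ?case by (simp add: eq) }
next
  case (insert x J)
  let ?S = "\<lambda>k. SIGMA t:{- int k..int k}. cross_ball J (k - nat \<bar>t\<bar>)"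
  have upd: "(\<Sum>j\<in>J. \<bar>(f(x := t)) j\<bar>) = (\<Sum>j\<in>J. \<bar>f j\<bar>)" for f :: "'a \<Rightarrow> int" and t
    using insert.hyps(2) by (intro sum.cong) auto
  have bij: "bij_betw (\<lambda>(t, f). f(x := t)) (?S k) (cross_ball (insert x J) k)" for k
  proof (rule bij_betw_byWitness[of _ "\<lambda>f. (f x, f(x := 0))"])
    show "\<forall>a\<in>(?S k). (\<lambda>f. (f x, f(x := 0))) ((\<lambda>(t, f). f(x := t)) a) = a"
      using insert.hyps(2) by (auto simp: cross_ball_def)
    show "(\<lambda>(t, f). f(x := t)) ` (?S k) \<subseteq> cross_ball (insert x J) k"
      using insert.hyps upd by (auto simp: cross_ball_def of_nat_diff nat_le_iff)
    show "(\<lambda>f. (f x, f(x := 0))) ` cross_ball (insert x J) k \<subseteq> (?S k)"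
    proof
      fix a assume "a \<in> (\<lambda>f. (f x, f(x := 0))) ` cross_ball (insert x J) k"
      then obtain f where f: "f \<in> cross_ball (insert x J) k" and a: "a = (f x, f(x := 0))" by auto
      have "\<bar>f x\<bar> + (\<Sum>j\<in>J. \<bar>f j\<bar>) \<le> int k"
        using f insert.hyps by (simp add: cross_ball_def)
      moreover have "(\<Sum>j\<in>J. \<bar>f j\<bar>) \<ge> 0" by (simp add: sum_nonneg)
      ultimately have "\<bar>f x\<bar> \<le> int k" "(\<Sum>j\<in>J. \<bar>f j\<bar>) \<le> int k - \<bar>f x\<bar>" by linarith+
      then have "f x \<in> {- int k..int k}"
        and "(\<Sum>j\<in>J. \<bar>(f(x := 0)) j\<bar>) \<le> int (k - nat \<bar>f x\<bar>)"
        unfolding upd by (simp_all add: abs_le_iff of_nat_diff nat_le_iff)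
      moreover have "(f(x := 0)) j = 0" if "j \<notin> J" for j
        using f that by (auto simp: cross_ball_def)
      ultimately show "a \<in> (?S k)" unfolding a cross_ball_def by blast
    qed
  qed auto
  { case 1
    have "finite (?S k)" using insert.IH(1) by auto
    then show ?case using bij_betw_finite[OF bij] by simp }
  { case 2
    let ?n = "card J"
    define g where "g k = (\<Sum>i\<le>?n. 2 ^ i * (?n choose i) * (k choose i))" for k
    have "card (cross_ball (insert x J) k) = card (?S k)" using bij_betw_same_card[OF bij] by simp
    also have "\<dots> = (\<Sum>t\<in>{- int k..int k}. g (k - nat \<bar>t\<bar>))"
      using insert.IH by (subst card_SigmaI) (auto simp: g_def)
    also have "\<dots> = g k + 2 * (\<Sum>j<k. g j)" by (rule sum_symmetric_range)
    also have "2 * (\<Sum>j<k. g j) = (\<Sum>i\<le>?n. 2 ^ Suc i * (?n choose i) * (\<Sum>j<k. j choose i))"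
      unfolding g_def by (subst sum.swap) (simp add: sum_distrib_left mult.assoc)
    also have "\<dots> = (\<Sum>i\<le>?n. 2 ^ Suc i * (?n choose i) * (k choose Suc i))"
      by (simp only: sum_choose_lessThan)
    also have "g k = (\<Sum>i\<le>Suc ?n. 2 ^ i * (?n choose i) * (k choose i))"
      by (simp add: g_def)
    also have "\<dots> = 1 + (\<Sum>i\<le>?n. 2 ^ Suc i * (?n choose Suc i) * (k choose Suc i))"
      by (simp only: sum.atMost_Suc_shift) simp
    also have "1 + (\<Sum>i\<le>?n. 2 ^ Suc i * (?n choose Suc i) * (k choose Suc i))
          + (\<Sum>i\<le>?n. 2 ^ Suc i * (?n choose i) * (k choose Suc i))
        = 1 + (\<Sum>i\<le>?n. 2 ^ Suc i * (Suc ?n choose Suc i) * (k choose Suc i))"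
      by (simp add: sum.distrib[symmetric] algebra_simps)
    also have "\<dots> = (\<Sum>i\<le>Suc ?n. 2 ^ i * (Suc ?n choose i) * (k choose i))"
      by (simp only: sum.atMost_Suc_shift) simp
    finally show ?case using insert.hyps by simp }
qed

section \<open>The degree\<close>

text \<open>The lattice points of the \<open>k\<close>-th dilate of the product of \<open>[-1, 1]\<close>, in direction \<open>c\<close>, and the
  cross polytope in the other directions.\<close>

definition prism_points :: "'d \<Rightarrow> nat \<Rightarrow> (int^'d::finite) set" where
  "prism_points c k = {b. \<bar>b $ c\<bar> \<le> int k \<and> (\<Sum>j\<in>-{c}. \<bar>b $ j\<bar>) \<le> int k}"

lemma card_prism_points:
  fixes c :: "'d::finite"
  shows "finite (prism_points c k)"
    and "card (prism_points c k) = (2 * k + 1) * card (cross_ball (-{c}) k)"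
proof -
  let ?S = "{- int k..int k} \<times> cross_ball (-{c}) k"
  have bij: "bij_betw (\<lambda>(t, f). \<chi> i. if i = c then t else f i) ?S (prism_points c k)"
    by (rule bij_betw_byWitness[of _ "\<lambda>b. (b $ c, \<lambda>i. if i = c then 0 else b $ i)"])
       (auto simp: cross_ball_def prism_points_def vec_eq_iff fun_eq_iff abs_le_iff)
  have "finite ?S" by (intro finite_cartesian_product card_cross_ball) auto
  then show "finite (prism_points c k)" using bij_betw_finite[OF bij] by simp
  show "card (prism_points c k) = (2 * k + 1) * card (cross_ball (-{c}) k)"
    using bij_betw_same_card[OF bij] by (simp add: card_cartesian_product nat_add_distrib nat_mult_distrib)
qed

lemma exponent_sum_add_single:
  "exponent_sum (m + Poly_Mapping.single a 1) = exponent_sum m + a"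
proof -
  have "exponent_sum (m + Poly_Mapping.single a 1) $ i = (exponent_sum m + a) $ i" for i
    unfolding exponent_sum_def vec_lambda_beta plus_vec_def
    by (subst setsum_keys_plus_distrib[where f = "\<lambda>a n. int n * a $ i"])
       (auto simp: lookup_single algebra_simps)
  then show ?thesis by (simp add: vec_eq_iff)
qed

lemma total_degree_add_single:
  "total_degree (m + Poly_Mapping.single a 1) = Suc (total_degree m)"
  unfolding total_degree_def
  by (subst setsum_keys_plus_distrib[where f = "\<lambda>_ n. n"]) (auto simp: lookup_single)

text \<open>One step of the decomposition: subtract the sign of the \<open>c\<close>-coordinate and of one other
  nonzero coordinate.\<close>

lemma prism_points_Suc:
  fixes c :: "'d::finite"
  assumes b: "b \<in> prism_points c (Suc k)"
  obtains a where "a \<in> prism_points c 1" and "b - a \<in> prism_points c k"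
proof -
  have sgn: "\<bar>x - sgn x\<bar> = (if x = 0 then 0 else \<bar>x\<bar> - 1)" "\<bar>sgn x\<bar> \<le> 1" for x :: int
    by (auto simp: sgn_if)
  have c: "\<bar>b $ c - sgn (b $ c)\<bar> \<le> int k" using b by (auto simp: sgn prism_points_def)
  show thesis
  proof (cases "\<exists>j. j \<noteq> c \<and> b $ j \<noteq> 0")
    case False
    define a :: "int^'d" where "a = (\<chi> i. if i = c then sgn (b $ c) else 0)"
    have "a \<in> prism_points c 1" by (simp add: a_def prism_points_def sgn)
    moreover have "(\<Sum>j\<in>-{c}. \<bar>(b - a) $ j\<bar>) = 0"
      using False by (intro sum.neutral) (auto simp: a_def)
    then have "b - a \<in> prism_points c k" using c by (simp add: a_def prism_points_def)
    ultimately show thesis by (rule that)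
  next
    case True
    then obtain j where j: "j \<in> -{c}" "j \<noteq> c" "b $ j \<noteq> 0" by auto
    define a :: "int^'d" where "a = (\<chi> i. if i = c \<or> i = j then sgn (b $ i) else 0)"
    have rm: "(\<Sum>i\<in>-{c}. f i) = f j + (\<Sum>i\<in>-{c} - {j}. f i)" for f :: "'d \<Rightarrow> int"
      using j(1) by (intro sum.remove) auto
    have "(\<Sum>i\<in>-{c} - {j}. \<bar>a $ i\<bar>) = 0" by (intro sum.neutral) (auto simp: a_def)
    then have "a \<in> prism_points c 1" by (simp add: prism_points_def rm a_def sgn)
    moreover have "(\<Sum>i\<in>-{c} - {j}. \<bar>(b - a) $ i\<bar>) = (\<Sum>i\<in>-{c} - {j}. \<bar>b $ i\<bar>)"
      by (intro sum.cong) (auto simp: a_def)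
    then have "b - a \<in> prism_points c k"
      using b c j(2,3) unfolding prism_points_def rm by (simp add: a_def sgn)
    ultimately show thesis by (rule that)
  qed
qed

text \<open>The triangle inequality gives one inclusion; iterating the previous step gives the other.\<close>

lemma exponent_sum_monomials_prism:
  fixes c :: "'d::finite"
  shows "exponent_sum ` monomials_of_degree (prism_points c 1) k = prism_points c k"
proof
  show "exponent_sum ` monomials_of_degree (prism_points c 1) k \<subseteq> prism_points c k"
  proof
    fix b :: "int^'d" assume "b \<in> exponent_sum ` monomials_of_degree (prism_points c 1) k"
    then obtain m where b: "b = exponent_sum m"
      and A: "Poly_Mapping.keys m \<subseteq> prism_points c 1" and k: "total_degree m = k"
      by (auto simp: monomials_of_degree_def)
    let ?K = "Poly_Mapping.keys m" and ?l = "\<lambda>a. int (Poly_Mapping.lookup m a)"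
    have sum_k: "(\<Sum>a\<in>?K. ?l a) = int k" using k by (auto simp: total_degree_def)
    have le: "\<bar>b $ i\<bar> \<le> (\<Sum>a\<in>?K. ?l a * \<bar>a $ i\<bar>)" for i
      unfolding b exponent_sum_def
      by (simp add: order.trans[OF sum_abs] abs_mult)
    have bound: "(\<Sum>a\<in>?K. ?l a * g a) \<le> int k" if "\<And>a. a \<in> ?K \<Longrightarrow> g a \<le> 1" for g :: "int^'d \<Rightarrow> int"
    proof -
      have "(\<Sum>a\<in>?K. ?l a * g a) \<le> (\<Sum>a\<in>?K. ?l a * 1)"
        using that by (intro sum_mono mult_left_mono) auto
      then show ?thesis by (simp add: sum_k)
    qed
    have "\<bar>b $ c\<bar> \<le> int k"
      using le[of c] by (rule order.trans) (rule bound, use A in \<open>auto simp: prism_points_def\<close>)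
    moreover have "(\<Sum>j\<in>-{c}. \<bar>b $ j\<bar>) \<le> (\<Sum>j\<in>-{c}. \<Sum>a\<in>?K. ?l a * \<bar>a $ j\<bar>)"
      by (intro sum_mono le)
    then have "(\<Sum>j\<in>-{c}. \<bar>b $ j\<bar>) \<le> (\<Sum>a\<in>?K. ?l a * (\<Sum>j\<in>-{c}. \<bar>a $ j\<bar>))"
      by (simp add: sum.swap[of _ ?K] sum_distrib_left)
    then have "(\<Sum>j\<in>-{c}. \<bar>b $ j\<bar>) \<le> int k"
      by (rule order.trans) (rule bound, use A in \<open>auto simp: prism_points_def\<close>)
    ultimately show "b \<in> prism_points c k" by (simp add: prism_points_def)
  qed
  show "prism_points c k \<subseteq> exponent_sum ` monomials_of_degree (prism_points c 1) k"
  proof (induction k)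
    case 0
    have "exponent_sum 0 = (0 :: int^'d)" by (simp add: exponent_sum_def vec_eq_iff)
    moreover have "(0 :: (int^'d) \<Rightarrow>\<^sub>0 nat) \<in> monomials_of_degree (prism_points c 1) 0"
      by (simp add: monomials_of_degree_def total_degree_def)
    moreover have "b = 0" if "b \<in> prism_points c 0" for b :: "int^'d"
    proof -
      have "(\<Sum>j\<in>-{c}. \<bar>b $ j\<bar>) = 0"
        by (intro antisym sum_nonneg) (use that in \<open>auto simp: prism_points_def\<close>)
      then have "b $ j = 0" if "j \<noteq> c" for j using that by (simp add: sum_nonneg_eq_0_iff)
      then show ?thesis using that by (metis (mono_tags, lifting) abs_le_zero_iff mem_Collect_eq
            of_nat_0 prism_points_def vec_eq_iff zero_index)
    qed
    ultimately show ?case by (metis image_eqI subsetI)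
  next
    case (Suc k)
    show ?case
    proof
      fix b assume "b \<in> prism_points c (Suc k)"
      then obtain a where a: "a \<in> prism_points c 1" "b - a \<in> prism_points c k"
        by (rule prism_points_Suc)
      with Suc obtain m where m: "m \<in> monomials_of_degree (prism_points c 1) k" "b - a = exponent_sum m"
        by auto
      let ?m = "m + Poly_Mapping.single a 1"
      have "Poly_Mapping.keys ?m \<subseteq> prism_points c 1"
        using keys_add[of m "Poly_Mapping.single a 1"] m(1) a(1)
        by (auto simp: monomials_of_degree_def)
      then have "?m \<in> monomials_of_degree (prism_points c 1) (Suc k)"
        using m(1) by (simp add: monomials_of_degree_def total_degree_add_single del: One_nat_def)
      moreover have "b = exponent_sum ?m"
        using m(2) by (simp add: exponent_sum_add_single algebra_simps del: One_nat_def)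
      ultimately show "b \<in> exponent_sum ` monomials_of_degree (prism_points c 1) (Suc k)" by blast
    qed
  qed
qed

definition choose_poly :: "nat \<Rightarrow> real poly" where
  "choose_poly i = smult (1 / fact i) (\<Prod>j<i. [:- of_nat j, 1:])"

lemma poly_choose_poly: "poly (choose_poly i) (real k) = real (k choose i)"
  by (simp add: choose_poly_def poly_prod binomial_gbinomial gbinomial_prod_rev atLeast0LessThan)

lemma degree_choose_poly: "Polynomial.degree (choose_poly i) = i"
  by (simp add: choose_poly_def degree_prod_eq_sum_degree)

lemma lead_coeff_choose_poly: "poly.coeff (choose_poly i) i = 1 / fact i"
proof -
  have "lead_coeff (\<Prod>j<i. [:- of_nat j, 1 :: real:]) = 1" by (simp add: lead_coeff_prod)
  then show ?thesis by (simp add: choose_poly_def degree_prod_eq_sum_degree)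
qed

text \<open>Two polynomials that agree at all large integers are equal, hence the degree is unique.\<close>

lemma cone_degreeI:
  assumes h: "\<And>k. real (hilbert_function A V k) = poly h (real k)"
    and e: "real e = fact (Polynomial.degree h) * lead_coeff h"
  shows "cone_degree A V = e"
proof -
  have "has_cone_degree A V e" unfolding has_cone_degree_def
    by (rule exI[of _ h]) (simp only: h e eventually_True simp_thms)
  moreover have "e' = e" if "has_cone_degree A V e'" for e'
  proof -
    obtain h' where h': "\<forall>\<^sub>F k in sequentially. real (hilbert_function A V k) = poly h' (real k)"
      and e': "real e' = fact (Polynomial.degree h') * lead_coeff h'"
      using \<open>has_cone_degree A V e'\<close> unfolding has_cone_degree_def by blast
    from h' obtain K where "\<forall>k\<ge>K. real (hilbert_function A V k) = poly h' (real k)"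
      unfolding eventually_sequentially by blast
    then have K: "poly (h' - h) (real k) = 0" if "k \<ge> K" for k using that by (simp add: h)
    have "infinite (real ` {K..})" by (simp add: finite_image_iff infinite_Ici)
    moreover have "real ` {K..} \<subseteq> {x. poly (h' - h) x = 0}" using K by auto
    ultimately have "h' - h = 0" using poly_roots_finite finite_subset by blast
    then show ?thesis using e e' by simp
  qed
  ultimately show ?thesis unfolding cone_degree_def by (metis the_equality)
qed

theorem cone_degree_prism:
  fixes c :: "'d::finite"
  shows "cone_degree (prism_points c 1) (toric_variety (prism_points c 1)) = CARD('d) * 2 ^ CARD('d)"
proof -
  define n where "n = CARD('d) - 1"
  have n: "CARD('d) = Suc n" by (simp add: n_def)
  have card: "card (-{c}) = n" by (simp add: n_def Compl_eq_Diff_UNIV)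
  define q where "q = (\<Sum>i\<le>n. smult (2 ^ i * of_nat (n choose i)) (choose_poly i))"
  have "Polynomial.degree q \<le> n" unfolding q_def
    by (intro degree_sum_le) (auto intro: order.trans[OF degree_smult_le] simp: degree_choose_poly)
  moreover have q_n: "poly.coeff q n = 2 ^ n / fact n"
  proof -
    have "poly.coeff q n = (\<Sum>i\<le>n. if i = n then 2 ^ n / fact n else 0)"
      unfolding q_def coeff_sum
      by (intro sum.cong) (auto simp: lead_coeff_choose_poly degree_choose_poly coeff_eq_0)
    then show ?thesis by simp
  qed
  ultimately have deg_q: "Polynomial.degree q = n"
    by (simp add: le_antisym le_degree)
  have "q \<noteq> 0" using q_n by auto
  define h where "h = [:1, 2:] * q"
  have deg_h: "Polynomial.degree h = Suc n"
    using \<open>q \<noteq> 0\<close> by (simp add: h_def degree_mult_eq deg_q del: mult_pCons_left)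
  have "lead_coeff h = 2 * (2 ^ n / fact n)"
    unfolding h_def lead_coeff_mult by (simp add: deg_q q_n)
  then have lead_h: "poly.coeff h (Suc n) = 2 * (2 ^ n / fact n)" by (simp only: deg_h)
  show ?thesis
  proof (rule cone_degreeI[of _ _ h])
    fix k
    have "hilbert_function (prism_points c 1) (toric_variety (prism_points c 1)) k
        = (2 * k + 1) * (\<Sum>i\<le>n. 2 ^ i * (n choose i) * (k choose i))"
      unfolding hilbert_function_toric_variety[OF card_prism_points(1)] exponent_sum_monomials_prism
        card_prism_points(2) card_cross_ball(2)[OF finite] card ..
    then show "real (hilbert_function (prism_points c 1) (toric_variety (prism_points c 1)) k)
        = poly h (real k)"
      by (simp add: h_def q_def poly_sum poly_choose_poly algebra_simps del: mult_pCons_left)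
  next
    show "real (CARD('d) * 2 ^ CARD('d)) = fact (Polynomial.degree h) * lead_coeff h"
      unfolding deg_h lead_h n by (simp add: field_simps)
  qed
qed

section \<open>The lattice points of the polytope\<close>

lemma sum_abs_axis: "finite J \<Longrightarrow> (\<Sum>j\<in>J. \<bar>axis i z $ j\<bar>) = (if i \<in> J then \<bar>z\<bar> else 0)"
  for z :: "'a::ordered_ab_group_add_abs"
proof -
  have "(\<Sum>j\<in>J. \<bar>axis i z $ j\<bar>) = (\<Sum>j\<in>J. if j = i then \<bar>z\<bar> else 0)"
    by (intro sum.cong) (auto simp: axis_def)
  then show "finite J \<Longrightarrow> ?thesis" by simp
qed

lemma axis_in_prism_points: "\<bar>z\<bar> \<le> 1 \<Longrightarrow> axis i z \<in> prism_points c 1"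
  by (auto simp: prism_points_def sum_abs_axis) (auto simp: axis_def)

lemma axis_add_axis_in_prism_points:
  assumes "\<bar>y\<bar> \<le> 1" "\<bar>z\<bar> \<le> 1" "j \<noteq> c"
  shows "axis c y + axis j z \<in> prism_points c 1"
proof -
  have "(\<Sum>i\<in>-{c}. \<bar>(axis c y + axis j z) $ i\<bar>) = (\<Sum>i\<in>-{c}. \<bar>axis j z $ i\<bar>)"
    by (intro sum.cong) (auto simp: axis_def)
  with assms show ?thesis by (simp add: prism_points_def sum_abs_axis) (simp add: axis_def)
qed

lemma prism_points_1_cases:
  fixes c :: "'d::finite"
  assumes a: "a \<in> prism_points c 1"
  obtains (axis) "\<bar>a $ c\<bar> \<le> 1" "a = axis c (a $ c)"
  | (axes) j where "j \<noteq> c" "\<bar>a $ c\<bar> \<le> 1" "\<bar>a $ j\<bar> = 1" "a = axis c (a $ c) + axis j (a $ j)"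
proof (cases "\<exists>j. j \<noteq> c \<and> a $ j \<noteq> 0")
  case False
  then have "a = axis c (a $ c)" by (auto simp: vec_eq_iff axis_def)
  moreover have "\<bar>a $ c\<bar> \<le> 1" using a by (simp add: prism_points_def)
  ultimately show thesis by (rule axis[rotated])
next
  case True
  then obtain j where j: "j \<noteq> c" "a $ j \<noteq> 0" by blast
  have "(\<Sum>i\<in>-{c}. \<bar>a $ i\<bar>) = \<bar>a $ j\<bar> + (\<Sum>i\<in>-{c} - {j}. \<bar>a $ i\<bar>)"
    using j(1) by (intro sum.remove) auto
  moreover have "(\<Sum>i\<in>-{c} - {j}. \<bar>a $ i\<bar>) \<ge> 0" by (simp add: sum_nonneg)
  moreover have "(\<Sum>i\<in>-{c}. \<bar>a $ i\<bar>) \<le> 1" using a by (simp add: prism_points_def)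
  ultimately have *: "\<bar>a $ j\<bar> = 1" "(\<Sum>i\<in>-{c} - {j}. \<bar>a $ i\<bar>) = 0"
    using j(2) by linarith+
  then have "a $ i = 0" if "i \<noteq> c" "i \<noteq> j" for i
    using that by (simp add: sum_nonneg_eq_0_iff)
  then have "a = axis c (a $ c) + axis j (a $ j)" using j(1) by (auto simp: vec_eq_iff axis_def)
  moreover have "\<bar>a $ c\<bar> \<le> 1" using a by (simp add: prism_points_def)
  ultimately show thesis using axes j(1) *(1) by blast
qed

text \<open>The convex set cut out by \<open>|x\<^sub>c| \<le> 1\<close> and \<open>\<Sum>\<^bsub>j \<noteq> c\<^esub> |x\<^sub>j| \<le> 1\<close> contains the generators of the
  polytope, and each of its integer points is a generator.\<close>

lemma lattice_points_star_polytope: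
  fixes c :: "'d::finite"
  shows "lattice_points (graph_polytope (star_edges c)) = prism_points c 1"
proof -
  define G :: "(real^'d) set" where "G = {0} \<union> {s *\<^sub>R axis i 1 | s i. s \<in> {1, -1}}
      \<union> {s *\<^sub>R axis i 1 + t *\<^sub>R axis j 1 | s t i j. s \<in> {1, -1} \<and> t \<in> {1, -1} \<and> {i, j} \<in> star_edges c}"
  define Q :: "(real^'d) set" where "Q = {x. \<bar>x $ c\<bar> \<le> 1 \<and> (\<Sum>j\<in>-{c}. \<bar>x $ j\<bar>) \<le> 1}"
  have scale: "s *\<^sub>R axis i 1 = axis i s" for s :: real and i :: 'd
    by (auto simp: vec_eq_iff axis_def)
  have "convex Q"
  proof (rule convexI)
    fix x y :: "real^'d" and u v :: real
    assume xy: "x \<in> Q" "y \<in> Q" and uv: "0 \<le> u" "0 \<le> v" "u + v = 1"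
    have le: "\<bar>(u *\<^sub>R x + v *\<^sub>R y) $ i\<bar> \<le> u * \<bar>x $ i\<bar> + v * \<bar>y $ i\<bar>" for i
      using abs_triangle_ineq[of "u * x $ i" "v * y $ i"] uv by (simp add: abs_mult)
    have comb: "u * p + v * q \<le> 1" if "p \<le> 1" "q \<le> 1" for p q :: real
      using that uv convex_bound_le by blast
    have "(\<Sum>j\<in>-{c}. \<bar>(u *\<^sub>R x + v *\<^sub>R y) $ j\<bar>) \<le> u * (\<Sum>j\<in>-{c}. \<bar>x $ j\<bar>) + v * (\<Sum>j\<in>-{c}. \<bar>y $ j\<bar>)"
      unfolding sum_distrib_left sum.distrib[symmetric] by (intro sum_mono le)
    also have "\<dots> \<le> 1" using xy by (intro comb) (auto simp: Q_def)
    finally show "u *\<^sub>R x + v *\<^sub>R y \<in> Q"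
      using order.trans[OF le[of c] comb] xy by (auto simp: Q_def)
  qed
  moreover have "G \<subseteq> Q"
  proof
    fix x assume "x \<in> G"
    then consider "x = 0" | s i where "s \<in> {1, -1}" "x = axis i s"
      | s t i where "s \<in> {1, -1}" "t \<in> {1, -1}" "i \<noteq> c" "x = axis c s + axis i t"
      unfolding G_def star_edges_def scale
      by (auto simp: doubleton_eq_iff) (metis add.commute)+
    then show "x \<in> Q"
    proof cases
      case 1
      then show ?thesis by (simp add: Q_def)
    next
      case 2
      then show ?thesis by (auto simp: Q_def sum_abs_axis) (auto simp: axis_def)
    next
      case 3
      have "(\<Sum>j\<in>-{c}. \<bar>x $ j\<bar>) = (\<Sum>j\<in>-{c}. \<bar>axis i t $ j\<bar>)"
        unfolding 3(4) by (intro sum.cong) (auto simp: axis_def)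
      then show ?thesis using 3 by (auto simp: Q_def sum_abs_axis) (auto simp: axis_def)
    qed
  qed
  ultimately have hull: "convex hull G \<subseteq> Q" by (rule hull_minimal[rotated])
  have poly: "graph_polytope (star_edges c) = convex hull G"
    unfolding graph_polytope_def G_def ..
  show ?thesis
  proof (intro equalityI subsetI)
    fix a assume "a \<in> lattice_points (graph_polytope (star_edges c))"
    then have "(\<chi> i. real_of_int (a $ i)) \<in> Q" using hull by (auto simp: poly lattice_points_def)
    then have "real_of_int \<bar>a $ c\<bar> \<le> real_of_int 1" "real_of_int (\<Sum>j\<in>-{c}. \<bar>a $ j\<bar>) \<le> real_of_int 1"
      by (simp_all add: Q_def)
    then show "a \<in> prism_points c 1" by (simp only: of_int_le_iff) (simp add: prism_points_def)
  next
    fix a assume a: "a \<in> prism_points c 1"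
    have unit: "x = 0 \<or> real_of_int x \<in> {1, -1}" if "\<bar>x\<bar> \<le> 1" for x using that by auto
    have real_axis: "(\<chi> i. real_of_int (axis j z $ i)) = axis j (real_of_int z)" for j z
      by (auto simp: vec_eq_iff axis_def)
    have axis_G: "axis j s \<in> G" if "s \<in> {1, -1}" for j s
      unfolding G_def scale using that by blast
    from a have "(\<chi> i. real_of_int (a $ i)) \<in> G"
    proof (cases rule: prism_points_1_cases)
      case axis
      then have x: "(\<chi> i. real_of_int (a $ i)) = axis c (real_of_int (a $ c))"
        by (metis real_axis)
      show ?thesis
      proof (cases "a $ c = 0")
        case True
        then show ?thesis unfolding x by (simp add: G_def)
      next
        case False
        then show ?thesis unfolding x using unit axis(1) by (blast intro: axis_G)
      qed
    next
      case (axes j)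
      have x: "(\<chi> i. real_of_int (a $ i)) = axis c (real_of_int (a $ c)) + axis j (real_of_int (a $ j))"
        by (subst axes(4)) (auto simp: vec_eq_iff axis_def)
      have j: "real_of_int (a $ j) \<in> {1, -1}" using axes(3) by auto
      show ?thesis
      proof (cases "a $ c = 0")
        case True
        then have "axis c (real_of_int (a $ c)) = 0" by (simp add: vec_eq_iff axis_def)
        then show ?thesis unfolding x using axis_G[OF j] by (simp only: add_0)
      next
        case False
        then have "real_of_int (a $ c) \<in> {1, -1}" using unit axes(2) by blast
        moreover have "{c, j} \<in> star_edges c" using axes(1) by (auto simp: star_edges_def)
        ultimately show ?thesis unfolding x G_def scale using j by blast
      qed
    qed
    then show "a \<in> lattice_points (graph_polytope (star_edges c))"
      by (simp add: lattice_points_def poly hull_inc)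
  qed
qed

section \<open>Torus points of the toric variety\<close>

definition laurent :: "complex^'d::finite \<Rightarrow> int^'d \<Rightarrow> complex" where
  "laurent \<theta> a = (\<Prod>i\<in>UNIV. (\<theta> $ i) powi (a $ i))"

lemma laurent_add: "(\<And>i. \<theta> $ i \<noteq> 0) \<Longrightarrow> laurent \<theta> (a + b) = laurent \<theta> a * laurent \<theta> b"
  by (simp add: laurent_def power_int_add prod.distrib)

lemma laurent_axis: "laurent \<theta> (axis i z) = (\<theta> $ i) powi z"
proof -
  have "laurent \<theta> (axis i z) = (\<Prod>j\<in>UNIV. if j = i then (\<theta> $ i) powi z else 1)"
    unfolding laurent_def by (intro prod.cong) (auto simp: axis_def)
  then show ?thesis by simp
qed

lemma toric_param_eq: "a \<in> A \<Longrightarrow> toric_param A s \<theta> a = s * laurent \<theta> a"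
  by (simp add: toric_param_def laurent_def)

lemma toric_param_in_toric_variety:
  assumes "s \<noteq> 0" and "\<And>i. \<theta> $ i \<noteq> 0"
  shows "toric_param A s \<theta> \<in> toric_variety A"
proof -
  have "{toric_param A s \<theta> | s \<theta>. s \<noteq> 0 \<and> (\<forall>i. \<theta> $ i \<noteq> 0)} \<subseteq> A \<rightarrow>\<^sub>E UNIV"
    by (auto simp: toric_param_def)
  from subset_zariski_closure[OF this] show ?thesis using assms unfolding toric_variety_def by blast
qed

lemma toric_variety_quadric:
  assumes p: "p \<in> toric_variety A" and A: "a \<in> A" "b \<in> A" "a' \<in> A" "b' \<in> A"
    and sum: "a + b = a' + b'"
  shows "p a * p b = p a' * p b'"
proof -
  define F :: "(int^'a) cpoly" where
    "F = Poly_Mapping.single (Poly_Mapping.single a 1 + Poly_Mapping.single b 1) 1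
       - Poly_Mapping.single (Poly_Mapping.single a' 1 + Poly_Mapping.single b' 1) 1"
  have eval: "poly_eval F x = x a * x b - x a' * x b'" for x
    by (simp add: F_def poly_eval_diff poly_eval_monomial monom_value_add monom_value_single)
  have keys: "Poly_Mapping.keys (Poly_Mapping.single a (1::nat) + Poly_Mapping.single b 1) \<subseteq> A"
    if "a \<in> A" "b \<in> A" for a b
    using keys_add[of "Poly_Mapping.single a (1::nat)" "Poly_Mapping.single b 1"] that by auto
  have "poly_vars F \<subseteq> A"
  proof -
    have "Poly_Mapping.keys F \<subseteq> {Poly_Mapping.single a 1 + Poly_Mapping.single b 1,
        Poly_Mapping.single a' 1 + Poly_Mapping.single b' 1}"
      by (auto simp: F_def in_keys_iff lookup_minus lookup_single when_def split: if_splits)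
    then show ?thesis using keys[OF A(1,2)] keys[OF A(3,4)] unfolding poly_vars_def by blast
  qed
  moreover have "poly_eval F (toric_param A s \<theta>) = 0" if "\<forall>i. \<theta> $ i \<noteq> 0" for s \<theta>
  proof -
    have "laurent \<theta> a * laurent \<theta> b = laurent \<theta> a' * laurent \<theta> b'"
      using that sum laurent_add[of \<theta>] by metis
    then show ?thesis by (simp add: eval toric_param_eq A)
  qed
  ultimately have "F \<in> vanishing_ideal A {toric_param A s \<theta> | s \<theta>. s \<noteq> 0 \<and> (\<forall>i. \<theta> $ i \<noteq> 0)}"
    by (auto simp: vanishing_ideal_def)
  with p have "poly_eval F p = 0" by (simp add: toric_variety_def zariski_closure_def)
  then show ?thesis by (simp add: eval)
qed

text \<open>Put \<open>s = p\<^sub>0\<close> and \<open>\<theta>\<^sub>i = p\<^bsub>e\<^sub>i\<^esub> / p\<^sub>0\<close>. The quadrics express every coordinate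
  through \<open>p\<^sub>0\<close> and the values of \<open>p\<close> at the unit vectors.\<close>

lemma prism_torus_points:
  fixes c :: "'d::finite"
  defines "A \<equiv> prism_points c 1"
  assumes p: "p \<in> toric_variety A" and nz: "\<And>a. a \<in> A \<Longrightarrow> p a \<noteq> 0"
  obtains s \<theta> where "s \<noteq> 0" "\<And>i. \<theta> $ i \<noteq> 0" "p = toric_param A s \<theta>"
proof -
  define s where "s = p 0"
  define \<theta> :: "complex^'d" where "\<theta> = (\<chi> i. p (axis i 1) / s)"
  have ax: "axis i z \<in> A" if "\<bar>z\<bar> \<le> 1" for i z using that unfolding A_def by (rule axis_in_prism_points)
  have "axis c 0 = (0 :: int^'d)" by (simp add: axis_def vec_eq_iff)
  then have zero: "0 \<in> A" using ax[of 0 c] by (metis abs_zero zero_le_one)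
  have s: "s \<noteq> 0" using nz zero by (simp add: s_def)
  have \<theta>: "\<theta> $ i \<noteq> 0" for i using nz[OF ax[of 1 i]] s by (simp add: \<theta>_def)
  have pos: "p (axis i 1) = s * \<theta> $ i" for i using s by (simp add: \<theta>_def)
  have p_axis: "p (axis i z) = s * laurent \<theta> (axis i z)" if z: "\<bar>z\<bar> \<le> 1" for i z
  proof -
    consider "z = 0" | "z = 1" | "z = -1" using z by linarith
    then show ?thesis
    proof cases
      case 1
      then have "axis i z = 0" by (simp add: axis_def vec_eq_iff)
      then have "p (axis i z) = s" by (simp only: s_def)
      then show ?thesis using 1 by (simp add: laurent_axis)
    next
      case 2
      then show ?thesis by (simp add: pos laurent_axis)
    next
      case 3
      have "p (axis i 1) * p (axis i (-1)) = p 0 * p 0"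
      proof (rule toric_variety_quadric[OF p])
        show "axis i 1 + axis i (-1) = (0 + 0 :: int^'d)" by (simp add: axis_def vec_eq_iff)
      qed (use ax zero in auto)
      then have "\<theta> $ i * p (axis i (-1)) = s" using s by (simp add: pos s_def[symmetric])
      then show ?thesis using \<theta>[of i] by (simp add: 3 laurent_axis power_int_minus field_simps)
    qed
  qed
  have "p a = s * laurent \<theta> a" if a: "a \<in> A" for a
    using a unfolding A_def
  proof (cases rule: prism_points_1_cases)
    case axis
    then show ?thesis using p_axis by metis
  next
    case (axes j)
    have "p a * p 0 = p (axis c (a $ c)) * p (axis j (a $ j))"
      by (rule toric_variety_quadric[OF p]) (use a zero ax axes in auto)
    then have "p a * s = s * (s * (laurent \<theta> (axis c (a $ c)) * laurent \<theta> (axis j (a $ j))))"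
      using axes(2,3) by (simp add: p_axis s_def[symmetric] mult_ac)
    also have "\<dots> = s * (s * laurent \<theta> a)"
      using axes(4) laurent_add[OF \<theta>] by metis
    finally show ?thesis using s by simp
  qed
  moreover have "p \<in> A \<rightarrow>\<^sub>E UNIV" using p by (simp add: toric_variety_def zariski_closure_def)
  ultimately have "p = toric_param A s \<theta>"
    unfolding fun_eq_iff toric_param_def laurent_def by (auto simp: PiE_def extensional_def)
  with s \<theta> show thesis by (rule that)
qed

section \<open>Critical points on a cross polytope\<close>

text \<open>The Laurent polynomial of the cross polytope with vertices \<open>\<plusminus>e\<^sub>j\<close>, \<open>j \<in> J\<close>. Dividing the score
  equations \<open>s (\<theta>\<^sub>j - 1/\<theta>\<^sub>j) = b\<^sub>j\<close> by the equation \<open>s G = 1\<close> for the total mass leads to the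
  system \<open>cross_critical\<close>.\<close>

definition cross_value :: "'j set \<Rightarrow> ('j \<Rightarrow> complex) \<Rightarrow> complex" where
  "cross_value J \<theta> = 1 + (\<Sum>j\<in>J. \<theta> j + 1 / \<theta> j)"

definition cross_critical :: "'j set \<Rightarrow> ('j \<Rightarrow> real) \<Rightarrow> ('j \<Rightarrow> complex) \<Rightarrow> bool" where
  "cross_critical J b \<theta> \<longleftrightarrow>
     (\<forall>j\<in>J. \<theta> j \<noteq> 0 \<and> \<theta> j - 1 / \<theta> j = of_real (b j) * cross_value J \<theta>)"

text \<open>For \<open>z = r e\<^bsup>i\<phi>\<^esup>\<close> the two imaginary parts are \<open>(r - 1/r) sin \<phi>\<close> and \<open>(r + 1/r) sin \<phi>\<close>.\<close>

lemma abs_Im_add_inverse_le: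
  assumes "z \<noteq> 0"
  shows "\<bar>Im (z + 1 / z)\<bar> \<le> \<bar>Im (z - 1 / z)\<bar>"
proof -
  have "Im (1 / z) = - Im z / (cmod z)\<^sup>2"
    by (simp add: Im_divide cmod_def)
  moreover have "(cmod z)\<^sup>2 > 0" using assms by simp
  ultimately have "Im (z + 1 / z) = Im z * (1 - 1 / (cmod z)\<^sup>2)"
    "Im (z - 1 / z) = Im z * (1 + 1 / (cmod z)\<^sup>2)"
    by (simp_all add: right_diff_distrib distrib_left)
  moreover have "1 / (cmod z)\<^sup>2 \<ge> 0" by simp
  then have "\<bar>1 - 1 / (cmod z)\<^sup>2\<bar> \<le> \<bar>1 + 1 / (cmod z)\<^sup>2\<bar>" by linarith
  ultimately show ?thesis by (simp only: abs_mult mult_left_mono abs_ge_zero)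
qed

text \<open>\<open>|Im G| \<le> \<Sum> |b\<^sub>j| |Im G|\<close> for the value \<open>G\<close>, by the previous inequality, so \<open>G\<close> is real; then
  \<open>|Im \<theta>\<^sub>j|\<close> is forced to vanish as well.\<close>

lemma cross_critical_real:
  assumes J: "finite J" and b: "(\<Sum>j\<in>J. \<bar>b j\<bar>) < 1" and crit: "cross_critical J b \<theta>"
  shows "cross_value J \<theta> \<in> \<real>" and "j \<in> J \<Longrightarrow> \<theta> j \<in> \<real>"
proof -
  define G where "G = cross_value J \<theta>"
  have "\<bar>Im G\<bar> = \<bar>\<Sum>j\<in>J. Im (\<theta> j + 1 / \<theta> j)\<bar>"
    by (simp add: G_def cross_value_def)
  also have "\<dots> \<le> (\<Sum>j\<in>J. \<bar>b j\<bar> * \<bar>Im G\<bar>)"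
  proof (rule order.trans[OF sum_abs sum_mono])
    fix j assume "j \<in> J"
    with crit have "\<theta> j \<noteq> 0" "\<theta> j - 1 / \<theta> j = of_real (b j) * G"
      by (auto simp: cross_critical_def G_def)
    with abs_Im_add_inverse_le[of "\<theta> j"] show "\<bar>Im (\<theta> j + 1 / \<theta> j)\<bar> \<le> \<bar>b j\<bar> * \<bar>Im G\<bar>"
      by (simp add: abs_mult)
  qed
  finally have le: "\<bar>Im G\<bar> \<le> (\<Sum>j\<in>J. \<bar>b j\<bar>) * \<bar>Im G\<bar>" by (simp add: sum_distrib_right)
  have ImG: "Im G = 0"
  proof (rule ccontr)
    assume "Im G \<noteq> 0"
    with b have "(\<Sum>j\<in>J. \<bar>b j\<bar>) * \<bar>Im G\<bar> < 1 * \<bar>Im G\<bar>" by (intro mult_strict_right_mono) auto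
    with le show False by simp
  qed
  then show "cross_value J \<theta> \<in> \<real>" by (simp add: complex_is_Real_iff G_def)
  assume "j \<in> J"
  with crit have nz: "\<theta> j \<noteq> 0" and "\<theta> j - 1 / \<theta> j = of_real (b j) * G"
    by (auto simp: cross_critical_def G_def)
  then have d: "Im (\<theta> j - 1 / \<theta> j) = 0" using ImG by simp
  with abs_Im_add_inverse_le[OF nz] have "Im (\<theta> j + 1 / \<theta> j) = 0" by simp
  with d have "Im (\<theta> j) = 0" by simp
  then show "\<theta> j \<in> \<real>" by (simp add: complex_is_Real_iff)
qed

text \<open>If the value were zero then every \<open>\<theta>\<^sub>j\<close> would be a sign, making the value an odd integer.\<close>

lemma cross_critical_value_nonzero:
  assumes crit: "cross_critical J b \<theta>"
  shows "cross_value J \<theta> \<noteq> 0"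
proof
  assume 0: "cross_value J \<theta> = 0"
  define \<epsilon> :: "'a \<Rightarrow> int" where "\<epsilon> j = (if \<theta> j = 1 then 1 else -1)" for j
  have "\<theta> j + 1 / \<theta> j = of_int (2 * \<epsilon> j)" if "j \<in> J" for j
  proof -
    from crit that 0 have "\<theta> j \<noteq> 0" "\<theta> j - 1 / \<theta> j = 0" by (auto simp: cross_critical_def)
    then have "(\<theta> j)\<^sup>2 = 1" by (simp add: field_simps power2_eq_square)
    then have "\<theta> j = 1 \<or> \<theta> j = -1" by (rule power2_eq_1_iff[THEN iffD1])
    then show ?thesis by (auto simp: \<epsilon>_def)
  qed
  then have "cross_value J \<theta> = 1 + (\<Sum>j\<in>J. of_int (2 * \<epsilon> j))"
    by (simp add: cross_value_def)
  also have "\<dots> = of_int (1 + 2 * (\<Sum>j\<in>J. \<epsilon> j))" by (simp add: sum_distrib_left)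
  finally have "of_int (1 + 2 * (\<Sum>j\<in>J. \<epsilon> j)) = (0 :: complex)" using 0 by simp
  then have "1 + 2 * (\<Sum>j\<in>J. \<epsilon> j) = 0" by (simp only: of_int_eq_0_iff)
  then show False by presburger
qed

text \<open>For real solutions, \<open>w\<^sub>j = \<theta>\<^sub>j + 1/\<theta>\<^sub>j\<close> satisfies \<open>w\<^sub>j\<^sup>2 = b\<^sub>j\<^sup>2 G\<^sup>2 + 4\<close> and has the sign
  \<open>\<epsilon>\<^sub>j\<close> of \<open>\<theta>\<^sub>j\<close>, so the value \<open>G\<close> is a fixed point of the following map, which is a contraction
  with constant \<open>\<Sum> |b\<^sub>j|\<close>.\<close>

definition cross_map :: "'j set \<Rightarrow> ('j \<Rightarrow> real) \<Rightarrow> ('j \<Rightarrow> real) \<Rightarrow> real \<Rightarrow> real" where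
  "cross_map J b \<epsilon> G = 1 + (\<Sum>j\<in>J. \<epsilon> j * sqrt ((b j * G)\<^sup>2 + 4))"

lemma sqrt_add_4_lipschitz: "\<bar>sqrt (x\<^sup>2 + 4) - sqrt (y\<^sup>2 + 4)\<bar> \<le> \<bar>x - y\<bar>"
proof -
  have "\<bar>norm (x, 2::real) - norm (y, 2::real)\<bar> \<le> norm ((x, 2::real) - (y, 2))"
    by (rule norm_triangle_ineq3)
  then show ?thesis by (simp add: norm_Pair)
qed

lemma cross_map_fixed_point:
  assumes "(\<Sum>j\<in>J. \<bar>b j\<bar>) < 1" and "\<And>j. j \<in> J \<Longrightarrow> \<bar>\<epsilon> j\<bar> = 1"
  shows "\<exists>!G. cross_map J b \<epsilon> G = G"
proof -
  have "dist (cross_map J b \<epsilon> G) (cross_map J b \<epsilon> H) \<le> (\<Sum>j\<in>J. \<bar>b j\<bar>) * dist G H" for G H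
  proof -
    have "dist (cross_map J b \<epsilon> G) (cross_map J b \<epsilon> H)
       = \<bar>\<Sum>j\<in>J. \<epsilon> j * (sqrt ((b j * G)\<^sup>2 + 4) - sqrt ((b j * H)\<^sup>2 + 4))\<bar>"
      by (simp add: cross_map_def dist_real_def sum_subtractf right_diff_distrib)
    also have "\<dots> \<le> (\<Sum>j\<in>J. \<bar>b j\<bar> * \<bar>G - H\<bar>)"
    proof (rule order.trans[OF sum_abs sum_mono])
      fix j assume "j \<in> J"
      with assms(2) sqrt_add_4_lipschitz[of "b j * G" "b j * H"]
      show "\<bar>\<epsilon> j * (sqrt ((b j * G)\<^sup>2 + 4) - sqrt ((b j * H)\<^sup>2 + 4))\<bar> \<le> \<bar>b j\<bar> * \<bar>G - H\<bar>"
        by (simp add: abs_mult right_diff_distrib[symmetric])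
    qed
    finally show ?thesis by (simp add: sum_distrib_right dist_real_def)
  qed
  then have "\<exists>!G\<in>UNIV. cross_map J b \<epsilon> G = G"
    using assms(1) by (intro Banach_fix[of _ "\<Sum>j\<in>J. \<bar>b j\<bar>"]) (auto simp: complete_UNIV sum_nonneg)
  then show ?thesis by simp
qed

lemma real_add_inverse_eq_sqrt:
  fixes x y :: real
  assumes "x \<noteq> 0" and "x - 1 / x = y"
  shows "x + 1 / x = sgn x * sqrt (y\<^sup>2 + 4)"
proof -
  have "(x + 1 / x)\<^sup>2 = (x - 1 / x)\<^sup>2 + 4"
    using assms(1) by (simp add: power2_sum power2_diff)
  then have "(x + 1 / x)\<^sup>2 = y\<^sup>2 + 4" by (simp only: assms(2))
  then have "sqrt (y\<^sup>2 + 4) = \<bar>x + 1 / x\<bar>" by (metis real_sqrt_abs)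
  also have "\<dots> = sgn x * (x + 1 / x)"
    using assms(1) by (cases "x > 0") (auto simp: field_simps)
  finally show ?thesis using assms(1) by (simp add: sgn_if)
qed

text \<open>Both values are fixed points of the map given by the common signs, so they agree; and
  \<open>2 \<theta>\<^sub>j = w\<^sub>j + b\<^sub>j G\<close> recovers the solution from its value and its signs.\<close>

lemma cross_critical_unique:
  assumes J: "finite J" and b: "(\<Sum>j\<in>J. \<bar>b j\<bar>) < 1"
    and crit: "cross_critical J b \<theta>" "cross_critical J b \<theta>'"
    and signs: "\<And>j. j \<in> J \<Longrightarrow> Re (\<theta> j) > 0 \<longleftrightarrow> Re (\<theta>' j) > 0"
    and j: "j \<in> J"
  shows "\<theta> j = \<theta>' j"
proof -
  define \<epsilon> where "\<epsilon> j = sgn (Re (\<theta> j))" for j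
  have key: "cross_map J b \<epsilon> (Re (cross_value J \<eta>)) = Re (cross_value J \<eta>) \<and>
      (\<forall>j\<in>J. \<bar>\<epsilon> j\<bar> = 1 \<and> 2 * \<eta> j = of_real (\<epsilon> j * sqrt ((b j * Re (cross_value J \<eta>))\<^sup>2 + 4)
         + b j * Re (cross_value J \<eta>)))"
    if c: "cross_critical J b \<eta>" and s: "\<And>j. j \<in> J \<Longrightarrow> Re (\<theta> j) > 0 \<longleftrightarrow> Re (\<eta> j) > 0" for \<eta>
  proof -
    define G where "G = Re (cross_value J \<eta>)"
    have G: "cross_value J \<eta> = of_real G"
      using cross_critical_real(1)[OF J b c] by (simp add: G_def)
    have *: "\<bar>\<epsilon> j\<bar> = 1 \<and> Re (\<eta> j + 1 / \<eta> j) = \<epsilon> j * sqrt ((b j * G)\<^sup>2 + 4) \<and>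
        2 * \<eta> j = of_real (\<epsilon> j * sqrt ((b j * G)\<^sup>2 + 4) + b j * G)" if j: "j \<in> J" for j
    proof -
      have nz: "\<theta> j \<noteq> 0" "\<eta> j \<noteq> 0" using crit(1) c j by (auto simp: cross_critical_def)
      obtain x where x: "\<eta> j = of_real x"
        using cross_critical_real(2)[OF J b c j] by (auto elim: Reals_cases)
      obtain y where y: "\<theta> j = of_real y"
        using cross_critical_real(2)[OF J b crit(1) j] by (auto elim: Reals_cases)
      from c j have "\<eta> j - 1 / \<eta> j = of_real (b j * G)" by (simp add: cross_critical_def G)
      then have "complex_of_real (x - 1 / x) = of_real (b j * G)" by (simp add: x)
      then have d: "x - 1 / x = b j * G" by (simp only: of_real_eq_iff)
      have "\<epsilon> j = sgn x" "\<bar>\<epsilon> j\<bar> = 1" using s[OF j] nz by (auto simp: \<epsilon>_def x y sgn_if)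
      with real_add_inverse_eq_sqrt[OF _ d] nz x
      have w: "x + 1 / x = \<epsilon> j * sqrt ((b j * G)\<^sup>2 + 4)" by simp
      have "2 * x = (x + 1 / x) + (x - 1 / x)" by simp
      then have "2 * x = \<epsilon> j * sqrt ((b j * G)\<^sup>2 + 4) + b j * G" by (simp only: d w)
      then have "complex_of_real (2 * x) = of_real (\<epsilon> j * sqrt ((b j * G)\<^sup>2 + 4) + b j * G)"
        by (simp only:)
      moreover have "Re (\<eta> j + 1 / \<eta> j) = x + 1 / x"
        unfolding x by (metis Re_complex_of_real of_real_1 of_real_add of_real_divide)
      ultimately show ?thesis using w \<open>\<bar>\<epsilon> j\<bar> = 1\<close> by (simp add: x)
    qed
    have "G = 1 + (\<Sum>j\<in>J. Re (\<eta> j + 1 / \<eta> j))" by (simp add: G_def cross_value_def)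
    also have "\<dots> = cross_map J b \<epsilon> G" using * by (simp add: cross_map_def)
    finally show ?thesis using * unfolding G_def[symmetric] by metis
  qed
  have k1: "cross_map J b \<epsilon> (Re (cross_value J \<theta>)) = Re (cross_value J \<theta>)"
    and s1: "\<And>j. j \<in> J \<Longrightarrow> \<bar>\<epsilon> j\<bar> = 1" using key[OF crit(1) refl] by blast+
  have k2: "cross_map J b \<epsilon> (Re (cross_value J \<theta>')) = Re (cross_value J \<theta>')"
    using key[OF crit(2) signs] by blast
  have "Re (cross_value J \<theta>) = Re (cross_value J \<theta>')"
    using cross_map_fixed_point[OF b, of \<epsilon>] s1 k1 k2 by blast
  moreover have "2 * \<theta> j = of_real (\<epsilon> j * sqrt ((b j * Re (cross_value J \<theta>))\<^sup>2 + 4)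
      + b j * Re (cross_value J \<theta>))" using key[OF crit(1) refl] j by blast
  moreover have "2 * \<theta>' j = of_real (\<epsilon> j * sqrt ((b j * Re (cross_value J \<theta>'))\<^sup>2 + 4)
      + b j * Re (cross_value J \<theta>'))" using key[OF crit(2) signs] j by blast
  ultimately have "2 * \<theta> j = 2 * \<theta>' j" by (simp only:)
  then show ?thesis by simp
qed

text \<open>Conversely, \<open>\<theta>\<^sub>j = (w\<^sub>j + b\<^sub>j G)/2\<close> with the fixed point \<open>G\<close> and \<open>w\<^sub>j = \<epsilon>\<^sub>j sqrt (b\<^sub>j\<^sup>2 G\<^sup>2 + 4)\<close> has
  inverse \<open>(w\<^sub>j - b\<^sub>j G)/2\<close>, and the sign of \<open>w\<^sub>j\<close>.\<close>

lemma cross_critical_exists: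
  assumes J: "finite J" and b: "(\<Sum>j\<in>J. \<bar>b j\<bar>) < 1"
  obtains \<theta> where "cross_critical J b \<theta>"
    and "\<And>j. j \<in> J \<Longrightarrow> Re (\<theta> j) > 0 \<longleftrightarrow> j \<in> P"
proof -
  define \<epsilon> :: "'a \<Rightarrow> real" where "\<epsilon> j = (if j \<in> P then 1 else -1)" for j
  have "\<bar>\<epsilon> j\<bar> = 1" for j by (simp add: \<epsilon>_def)
  then obtain G where G: "cross_map J b \<epsilon> G = G"
    using cross_map_fixed_point[OF b, of \<epsilon>] by blast
  define w where "w j = \<epsilon> j * sqrt ((b j * G)\<^sup>2 + 4)" for j
  define x where "x j = (w j + b j * G) / 2" for j
  have w2: "(w j)\<^sup>2 = (b j * G)\<^sup>2 + 4" for j by (simp add: w_def \<epsilon>_def power_mult_distrib)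
  have gt: "sqrt ((b j * G)\<^sup>2 + 4) > \<bar>b j * G\<bar>" for j
    by (rule real_less_rsqrt) simp
  have pos: "x j > 0 \<longleftrightarrow> j \<in> P" for j
    using gt[of j] by (auto simp: x_def w_def \<epsilon>_def)
  have prod: "x j * ((w j - b j * G) / 2) = 1" for j
    using w2[of j] by (simp add: x_def power2_eq_square algebra_simps)
  have nz: "x j \<noteq> 0" for j using prod[of j] by (metis mult_zero_left zero_neq_one)
  have inv: "1 / x j = (w j - b j * G) / 2" for j
    using prod[of j] nz[of j] by (simp add: divide_eq_eq mult.commute)
  have add: "x j + 1 / x j = w j" and sub: "x j - 1 / x j = b j * G" for j
    unfolding inv unfolding x_def by (simp_all add: field_simps)
  define \<theta> where "\<theta> j = complex_of_real (x j)" for j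
  have "cross_value J \<theta> = of_real (1 + (\<Sum>j\<in>J. x j + 1 / x j))"
    by (simp add: cross_value_def \<theta>_def)
  also have "1 + (\<Sum>j\<in>J. x j + 1 / x j) = cross_map J b \<epsilon> G"
    unfolding add by (simp add: cross_map_def w_def)
  also note G
  finally have val: "cross_value J \<theta> = of_real G" .
  have "\<theta> j - 1 / \<theta> j = of_real (b j * G)" for j
    unfolding sub[of j, symmetric] by (simp add: \<theta>_def)
  then have "cross_critical J b \<theta>"
    using nz by (simp add: cross_critical_def val \<theta>_def)
  moreover have "Re (\<theta> j) > 0 \<longleftrightarrow> j \<in> P" for j using pos by (simp add: \<theta>_def)
  ultimately show thesis by (rule that)
qed

section \<open>The maximum likelihood degree\<close>

text \<open>Positivity of the data is a generic condition, being implied by \<open>\<Prod>\<^sub>a u\<^sub>a \<noteq> 0\<close>. No other number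
  can be the degree, because every nonzero polynomial is nonzero at some positive data vector.\<close>

lemma ml_degreeI:
  assumes A: "finite A"
    and sol: "\<And>u. (\<And>a. a \<in> A \<Longrightarrow> u a > 0) \<Longrightarrow>
      finite (score_solutions A V u) \<and> card (score_solutions A V u) = m"
  shows "ml_degree A V = m"
proof -
  define X where "X = (\<Sum>a\<in>A. Poly_Mapping.single a (1::nat))"
  define F :: "(int^'a) cpoly" where "F = Poly_Mapping.single X 1"
  have X: "Poly_Mapping.keys X \<subseteq> A" "monom_value x X = (\<Prod>a\<in>A. x a)" for x
  proof -
    have "Poly_Mapping.keys (\<Sum>a\<in>B. Poly_Mapping.single a (1::nat)) \<subseteq> B \<and>
        monom_value x (\<Sum>a\<in>B. Poly_Mapping.single a 1) = (\<Prod>a\<in>B. x a)" if "finite B" for B x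
      using that
    proof (induction B rule: finite_induct)
      case (insert a B)
      then show ?case using keys_add[of "Poly_Mapping.single a (1::nat)" "\<Sum>a\<in>B. Poly_Mapping.single a (1::nat)"]
        by (auto simp: monom_value_add monom_value_single)
    qed (simp add: monom_value_def)
    from this[OF A] show "Poly_Mapping.keys X \<subseteq> A" "monom_value x X = (\<Prod>a\<in>A. x a)"
      by (auto simp: X_def)
  qed
  have "F \<noteq> 0" unfolding F_def by (metis lookup_single_eq lookup_zero zero_neq_one)
  moreover have "poly_vars F \<subseteq> A" using X(1) by (auto simp: F_def poly_vars_def)
  moreover have "finite (score_solutions A V u) \<and> card (score_solutions A V u) = m"
    if "poly_eval F (\<lambda>a. of_nat (u a)) \<noteq> 0" for u :: "int^'a \<Rightarrow> nat"
    using that A by (intro sol) (auto simp: F_def poly_eval_monomial X(2))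
  ultimately have "has_ml_degree A V m" unfolding has_ml_degree_def by blast
  moreover have "m' = m" if "has_ml_degree A V m'" for m'
  proof -
    obtain F' where F': "F' \<noteq> 0" "poly_vars F' \<subseteq> A" and
      card: "\<And>u :: int^'a \<Rightarrow> nat. poly_eval F' (\<lambda>a. of_nat (u a)) \<noteq> 0 \<Longrightarrow> card (score_solutions A V u) = m'"
      using \<open>has_ml_degree A V m'\<close> unfolding has_ml_degree_def by blast
    have keys: "Poly_Mapping.keys n \<subseteq> A" if "n \<in> Poly_Mapping.keys F'" for n
      using that F'(2) by (auto simp: poly_vars_def)
    obtain n where n: "n \<in> Poly_Mapping.keys F'" "Poly_Mapping.lookup F' n \<noteq> 0"
      using F'(1) by (metis in_keys_iff lookup_zero poly_mapping_eqI)
    have distinct: "\<exists>a\<in>A. int (Poly_Mapping.lookup k a) \<noteq> int (Poly_Mapping.lookup l a)"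
      if kl: "k \<in> Poly_Mapping.keys F'" "l \<in> Poly_Mapping.keys F'" "k \<noteq> l" for k l
    proof -
      have "\<not> (\<forall>a. Poly_Mapping.lookup k a = Poly_Mapping.lookup l a)"
        using kl(3) by (auto intro: poly_mapping_eqI)
      then obtain a where a: "Poly_Mapping.lookup k a \<noteq> Poly_Mapping.lookup l a" by blast
      then have "a \<in> Poly_Mapping.keys k \<union> Poly_Mapping.keys l" by (auto simp: in_keys_iff)
      then show ?thesis using a kl keys by (intro bexI[of _ a]) auto
    qed
    obtain u :: "int^'a \<Rightarrow> nat" where u: "\<And>a. u a > 0" and
      "(\<Sum>k\<in>Poly_Mapping.keys F'. Poly_Mapping.lookup F' k
         * (\<Prod>a\<in>A. of_nat (u a) powi int (Poly_Mapping.lookup k a))) \<noteq> 0"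
      by (rule laurent_sum_nonzero[of A "Poly_Mapping.keys F'"
            "\<lambda>k a. int (Poly_Mapping.lookup k a)" n "Poly_Mapping.lookup F'", OF A finite_keys distinct n])
         (assumption | rule that)+
    then have "poly_eval F' (\<lambda>a. of_nat (u a)) \<noteq> 0"
      using keys by (simp add: poly_eval_superset[OF finite_keys order_refl] monom_value_superset[OF A])
    then show ?thesis using card sol[of u] u by metis
  qed
  ultimately show ?thesis unfolding ml_degree_def by (metis the_equality)
qed

lemma prism_points_1_eq:
  fixes c :: "'d::finite"
  shows "prism_points c 1 = (\<lambda>z. axis c z) ` {-1, 0, 1}
    \<union> (\<lambda>(z, j, y). axis c z + axis j y) ` ({-1, 0, 1} \<times> (-{c}) \<times> {-1, 1})" (is "_ = ?R")
proof (intro equalityI subsetI)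
  fix a assume "a \<in> prism_points c 1"
  then show "a \<in> ?R"
  proof (cases rule: prism_points_1_cases)
    case axis
    have "a $ c \<in> {-1, 0, 1}" using axis(1) by auto
    then show ?thesis using axis(2) by blast
  next
    case (axes j)
    have "(a $ c, j, a $ j) \<in> {-1, 0, 1} \<times> (-{c}) \<times> {-1, 1}" using axes(1-3) by auto
    then show ?thesis using axes(4) by (metis (no_types, lifting) UnI2 case_prod_conv image_eqI)
  qed
next
  fix a assume "a \<in> ?R"
  then show "a \<in> prism_points c 1"
    by (elim UnE imageE) (auto intro!: axis_in_prism_points[unfolded One_nat_def]
        axis_add_axis_in_prism_points[unfolded One_nat_def])
qed

lemma sum_prism_points_1:
  fixes c :: "'d::finite" and h :: "int^'d \<Rightarrow> 'b::comm_monoid_add"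
  shows "(\<Sum>a\<in>prism_points c 1. h a)
    = (\<Sum>z\<in>{-1, 0, 1}. h (axis c z) + (\<Sum>j\<in>-{c}. \<Sum>y\<in>{-1, 1}. h (axis c z + axis j y)))"
proof -
  let ?f = "\<lambda>z. axis c z :: int^'d" and ?g = "\<lambda>(z, j, y). axis c z + axis j y :: int^'d"
  let ?Z = "{-1, 0, 1} :: int set" and ?T = "({-1, 0, 1} \<times> (-{c}) \<times> {-1, 1}) :: (int \<times> 'd \<times> int) set"
  have f: "inj_on ?f ?Z" by (auto simp: inj_on_def axis_eq_axis)
  have at_c: "?g (z, j, y) $ c = z" and at_j: "?g (z, j, y) $ i = (if i = j then y else 0)"
    if "j \<noteq> c" "i \<noteq> c" for z j y i
    using that by (auto simp: axis_def)
  have g: "inj_on ?g ?T"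
  proof (rule inj_onI)
    fix s t assume s: "s \<in> ?T" and t: "t \<in> ?T" and eq: "?g s = ?g t"
    obtain z j y z' j' y' where st: "s = (z, j, y)" "t = (z', j', y')" by (metis prod_cases3)
    have *: "j \<noteq> c" "j' \<noteq> c" "y \<noteq> 0" "y' \<noteq> 0" using s t by (auto simp: st)
    have "z = z'" using eq at_c[OF *(1,1)] at_c[OF *(2,2)] unfolding st by metis
    moreover have "y = (if j = j' then y' else 0)"
      using eq at_j[OF *(1,1), of z y] at_j[OF *(2,1), of z' y'] unfolding st by metis
    ultimately show "s = t" using * by (auto simp: st split: if_splits)
  qed
  have "?f z \<noteq> ?g t" if "t \<in> ?T" for z t
  proof
    assume eq: "?f z = ?g t"
    obtain z' j y where t: "t = (z', j, y)" by (metis prod_cases3)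
    have *: "j \<noteq> c" "y \<noteq> 0" using that by (auto simp: t)
    have "axis c z $ j = (0::int)" using *(1) by (simp add: axis_def)
    with at_j[OF *(1,1), of z' y] *(2) eq show False unfolding t by simp
  qed
  then have disj: "?f ` ?Z \<inter> ?g ` ?T = {}" by blast
  have "(\<Sum>a\<in>prism_points c 1. h a) = (\<Sum>a\<in>?f ` ?Z. h a) + (\<Sum>a\<in>?g ` ?T. h a)"
    unfolding prism_points_1_eq using disj by (intro sum.union_disjoint) auto
  also have "\<dots> = (\<Sum>z\<in>?Z. h (axis c z)) + (\<Sum>z\<in>?Z. \<Sum>j\<in>-{c}. \<Sum>y\<in>{-1, 1}. h (axis c z + axis j y))"
    unfolding sum.reindex[OF f] sum.reindex[OF g] sum.cartesian_product
    by (intro arg_cong2[of _ _ _ _ "(+)"] sum.cong) auto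
  finally show ?thesis by (simp only: sum.distrib)
qed

text \<open>The Laurent polynomial of the prism is the product of those of the segment and of the cross
  polytope; its Euler derivatives factor accordingly.\<close>

lemma sum_laurent_prism:
  fixes c :: "'d::finite" and \<theta> :: "complex^'d"
  defines "A \<equiv> prism_points c 1"
  assumes \<theta>: "\<And>i. \<theta> $ i \<noteq> 0"
  shows "(\<Sum>a\<in>A. laurent \<theta> a) = cross_value {c} (($) \<theta>) * cross_value (-{c}) (($) \<theta>)"
    and "(\<Sum>a\<in>A. of_int (a $ c) * laurent \<theta> a)
      = (\<theta> $ c - 1 / \<theta> $ c) * cross_value (-{c}) (($) \<theta>)"
    and "j \<noteq> c \<Longrightarrow> (\<Sum>a\<in>A. of_int (a $ j) * laurent \<theta> a)
      = cross_value {c} (($) \<theta>) * (\<theta> $ j - 1 / \<theta> $ j)"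
proof -
  have inv: "x powi (-1) = 1 / x" for x :: complex by (simp add: power_int_minus field_simps)
  have lau: "laurent \<theta> (axis c z + axis j y) = (\<theta> $ c) powi z * (\<theta> $ j) powi y" for z j y
    by (simp add: laurent_add \<theta> laurent_axis)
  show "(\<Sum>a\<in>A. laurent \<theta> a) = cross_value {c} (($) \<theta>) * cross_value (-{c}) (($) \<theta>)"
    unfolding A_def sum_prism_points_1 lau laurent_axis
    by (simp add: inverse_eq_divide cross_value_def sum.distrib sum_distrib_left algebra_simps)
  have "(\<Sum>a\<in>A. of_int (a $ c) * laurent \<theta> a)
    = (\<Sum>z\<in>{-1, 0, 1}. of_int z * (\<theta> $ c) powi z
        + (\<Sum>j\<in>-{c}. \<Sum>y\<in>{-1, 1}. of_int z * ((\<theta> $ c) powi z * (\<theta> $ j) powi y)))"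
    unfolding A_def sum_prism_points_1 lau laurent_axis
    by (intro sum.cong arg_cong2[of _ _ _ _ "(+)"] refl) (auto simp: axis_def)
  also have "\<dots> = (\<Sum>z\<in>{-1, 0, 1}. of_int z * (\<theta> $ c) powi z * cross_value (-{c}) (($) \<theta>))"
    by (intro sum.cong refl)
      (simp add: inverse_eq_divide cross_value_def sum.distrib sum_distrib_left algebra_simps)
  finally show "(\<Sum>a\<in>A. of_int (a $ c) * laurent \<theta> a)
      = (\<theta> $ c - 1 / \<theta> $ c) * cross_value (-{c}) (($) \<theta>)"
    by (simp add: inverse_eq_divide algebra_simps)
  assume j: "j \<noteq> c"
  have "(\<Sum>a\<in>A. of_int (a $ j) * laurent \<theta> a)
    = (\<Sum>z\<in>{-1, 0, 1}. 0
        + (\<Sum>i\<in>-{c}. if i = j then (\<theta> $ c) powi z * (\<theta> $ j - 1 / \<theta> $ j) else 0))"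
    unfolding A_def sum_prism_points_1 lau laurent_axis
    by (intro sum.cong arg_cong2[of _ _ _ _ "(+)"] refl) (use j in \<open>auto simp: axis_def divide_inverse algebra_simps\<close>)
  also have "\<dots> = (\<Sum>z\<in>{-1, 0, 1}. (\<theta> $ c) powi z * (\<theta> $ j - 1 / \<theta> $ j))"
    using j by simp
  also have "\<dots> = cross_value {c} (($) \<theta>) * (\<theta> $ j - 1 / \<theta> $ j)"
    by (simp add: inverse_eq_divide cross_value_def algebra_simps)
  finally show "(\<Sum>a\<in>A. of_int (a $ j) * laurent \<theta> a)
      = cross_value {c} (($) \<theta>) * (\<theta> $ j - 1 / \<theta> $ j)" .
qed

text \<open>The bound is strict because the point \<open>0\<close> carries positive weight.\<close>

lemma weighted_average_interior:
  fixes A :: "(int^'d::finite) set" and w :: "int^'d \<Rightarrow> real"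
  assumes A: "finite A" and zero: "0 \<in> A" and w: "\<And>a. a \<in> A \<Longrightarrow> w a > 0"
    and le: "\<And>a. a \<in> A \<Longrightarrow> (\<Sum>j\<in>J. \<bar>a $ j\<bar>) \<le> 1"
  shows "(\<Sum>j\<in>J. \<bar>(\<Sum>a\<in>A. of_int (a $ j) * w a) / (\<Sum>a\<in>A. w a)\<bar>) < 1"
proof -
  have pos: "(\<Sum>a\<in>A. w a) > 0" using A zero w by (intro sum_pos) auto
  have "(\<Sum>j\<in>J. \<bar>\<Sum>a\<in>A. of_int (a $ j) * w a\<bar>) \<le> (\<Sum>j\<in>J. \<Sum>a\<in>A. of_int \<bar>a $ j\<bar> * w a)"
    by (intro sum_mono order.trans[OF sum_abs]) (use w in \<open>simp add: abs_mult less_imp_le\<close>)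
  also have "\<dots> = (\<Sum>a\<in>A. of_int (\<Sum>j\<in>J. \<bar>a $ j\<bar>) * w a)"
    by (subst sum.swap) (simp add: sum_distrib_right)
  also have "\<dots> < (\<Sum>a\<in>A. w a)"
  proof (rule sum_strict_mono_ex1[OF A])
    show "\<forall>a\<in>A. of_int (\<Sum>j\<in>J. \<bar>a $ j\<bar>) * w a \<le> w a"
    proof
      fix a assume a: "a \<in> A"
      have "real_of_int (\<Sum>j\<in>J. \<bar>a $ j\<bar>) \<le> 1" using le[OF a] by (simp only: of_int_le_1_iff)
      then show "of_int (\<Sum>j\<in>J. \<bar>a $ j\<bar>) * w a \<le> w a" using w[OF a] by simp
    qed
    show "\<exists>a\<in>A. of_int (\<Sum>j\<in>J. \<bar>a $ j\<bar>) * w a < w a"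
      using zero w[OF zero] by (intro bexI[of _ 0]) auto
  qed
  finally show ?thesis using pos by (simp add: sum_divide_distrib[symmetric])
qed

lemma cross_critical_cong:
  "(\<And>j. j \<in> J \<Longrightarrow> \<theta> j = \<theta>' j) \<Longrightarrow> cross_critical J b \<theta> \<longleftrightarrow> cross_critical J b \<theta>'"
  by (simp add: cross_critical_def cross_value_def)

text \<open>All solutions being real, a sign pattern is the set of positive coordinates; the two systems
  contribute the two parts of this set independently.\<close>

lemma card_cross_critical_pair:
  fixes c :: "'d::finite" and b :: "'d \<Rightarrow> real"
  assumes b: "(\<Sum>j\<in>{c}. \<bar>b j\<bar>) < 1" "(\<Sum>j\<in>-{c}. \<bar>b j\<bar>) < 1"
  defines "T \<equiv> {\<theta> :: complex^'d. cross_critical {c} b (($) \<theta>) \<and> cross_critical (-{c}) b (($) \<theta>)}"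
  shows "finite T" and "card T = 2 ^ CARD('d)"
proof -
  define pos where "pos \<theta> = {i. Re (\<theta> $ i) > 0}" for \<theta> :: "complex^'d"
  have inj: "inj_on pos T"
  proof (rule inj_onI)
    fix \<theta> \<theta>' assume T: "\<theta> \<in> T" "\<theta>' \<in> T" and "pos \<theta> = pos \<theta>'"
    then have signs: "Re (\<theta> $ i) > 0 \<longleftrightarrow> Re (\<theta>' $ i) > 0" for i by (auto simp: pos_def)
    have "\<theta> $ i = \<theta>' $ i" for i
    proof (cases "i = c")
      case True
      show ?thesis
        by (rule cross_critical_unique[OF _ b(1)]) (use T signs True in \<open>auto simp: T_def\<close>)
    next
      case False
      show ?thesis
        by (rule cross_critical_unique[OF _ b(2)]) (use T signs False in \<open>auto simp: T_def\<close>)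
    qed
    then show "\<theta> = \<theta>'" by (simp add: vec_eq_iff)
  qed
  have "P \<in> pos ` T" for P
  proof -
    obtain \<theta>1 where 1: "cross_critical {c} b \<theta>1" "\<And>j. j \<in> {c} \<Longrightarrow> Re (\<theta>1 j) > 0 \<longleftrightarrow> j \<in> P"
      using cross_critical_exists[OF _ b(1), where P = P] by auto
    obtain \<theta>2 where 2: "cross_critical (-{c}) b \<theta>2" "\<And>j. j \<in> -{c} \<Longrightarrow> Re (\<theta>2 j) > 0 \<longleftrightarrow> j \<in> P"
      using cross_critical_exists[OF _ b(2), where P = P] by auto
    define \<theta> :: "complex^'d" where "\<theta> = (\<chi> i. if i = c then \<theta>1 i else \<theta>2 i)"
    have "\<theta> \<in> T"
      using 1(1) 2(1) cross_critical_cong[of "{c}" "($) \<theta>" \<theta>1] cross_critical_cong[of "-{c}" "($) \<theta>" \<theta>2]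
      by (simp add: T_def \<theta>_def)
    moreover have "pos \<theta> = P" using 1(2) 2(2) by (auto simp: pos_def \<theta>_def)
    ultimately show ?thesis by blast
  qed
  then have bij: "bij_betw pos T UNIV" using inj by (auto simp: bij_betw_def)
  show "finite T" using bij_betw_finite[OF bij] by simp
  show "card T = 2 ^ CARD('d)" using bij_betw_same_card[OF bij] by (simp add: card_UNIV_set)
qed

lemma toric_param_eq_prismD:
  fixes c :: "'d::finite"
  assumes eq: "toric_param (prism_points c 1) s \<theta> = toric_param (prism_points c 1) s' \<theta>'"
    and s: "s \<noteq> 0"
  shows "s = s'" and "\<theta> = \<theta>'"
proof -
  have ax: "s * (\<theta> $ i) powi z = s' * (\<theta>' $ i) powi z" if "\<bar>z\<bar> \<le> 1" for z i
    using fun_cong[OF eq, of "axis i z"] axis_in_prism_points[OF that, of i c]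
    by (simp add: toric_param_eq laurent_axis)
  from ax[of 0] show "s = s'" by simp
  with ax[of 1] s show "\<theta> = \<theta>'" by (simp add: vec_eq_iff)
qed

text \<open>Writing \<open>f\<close> and \<open>g\<close> for the two factors of the Laurent polynomial, the score equations say
  \<open>s = 1/(f g)\<close> together with the critical systems of the segment and of the cross polytope; conversely
  neither factor vanishes at critical points, so that \<open>s\<close> exists.\<close>

theorem ml_degree_prism:
  fixes c :: "'d::finite"
  defines "A \<equiv> prism_points c 1"
  shows "ml_degree A (toric_variety A) = 2 ^ CARD('d)"
proof (rule ml_degreeI)
  show A: "finite A" unfolding A_def by (rule card_prism_points)
  fix u :: "int^'d \<Rightarrow> nat" assume u: "\<And>a. a \<in> A \<Longrightarrow> u a > 0"
  define N where "N = (\<Sum>a\<in>A. u a)"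
  define b where "b i = (\<Sum>a\<in>A. of_int (a $ i) * real (u a)) / (\<Sum>a\<in>A. real (u a))" for i
  have zero: "0 \<in> A" by (simp add: A_def prism_points_def)
  then have N: "N > 0" unfolding N_def using A u by (intro sum_pos) auto
  have b: "(\<Sum>j\<in>{c}. \<bar>b j\<bar>) < 1" "(\<Sum>j\<in>-{c}. \<bar>b j\<bar>) < 1"
    unfolding b_def by (rule weighted_average_interior[OF A zero];
        use u in \<open>force simp: A_def prism_points_def\<close>)+
  define f g where "f \<theta> = cross_value {c} (($) \<theta>)" and "g \<theta> = cross_value (-{c}) (($) \<theta>)"
    for \<theta> :: "complex^'d"
  define T where "T = {\<theta> :: complex^'d. cross_critical {c} b (($) \<theta>) \<and> cross_critical (-{c}) b (($) \<theta>)}"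
  have rhs: "1 / of_nat N * (\<Sum>a\<in>A. of_int (a $ i) * of_nat (u a)) = complex_of_real (b i)" for i
    by (simp add: b_def N_def)
  have rhs1: "1 / of_nat N * (\<Sum>a\<in>A. of_nat (u a)) = (1::complex)"
    using N by (simp add: N_def flip: of_nat_sum)
  have score: "(\<forall>r. (\<Sum>a\<in>A. of_int (design_entry r a) * toric_param A s \<theta> a)
        = 1 / of_nat N * (\<Sum>a\<in>A. of_int (design_entry r a) * of_nat (u a)))
      \<longleftrightarrow> s * (f \<theta> * g \<theta>) = 1 \<and> s * ((\<theta> $ c - 1 / \<theta> $ c) * g \<theta>) = of_real (b c)
        \<and> (\<forall>j. j \<noteq> c \<longrightarrow> s * (f \<theta> * (\<theta> $ j - 1 / \<theta> $ j)) = of_real (b j))"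
    if \<theta>: "\<And>i. \<theta> $ i \<noteq> 0" for s \<theta>
  proof -
    have lhs: "(\<Sum>a\<in>A. of_int (design_entry r a) * toric_param A s \<theta> a)
        = s * (\<Sum>a\<in>A. of_int (design_entry r a) * laurent \<theta> a)" for r
      unfolding sum_distrib_left by (intro sum.cong) (auto simp: toric_param_eq)
    have split: "(\<forall>r. P r) \<longleftrightarrow> P None \<and> P (Some c) \<and> (\<forall>j. j \<noteq> c \<longrightarrow> P (Some j))"
      for P :: "'d option \<Rightarrow> bool" by (metis option.exhaust)
    note sums = sum_laurent_prism[where c = c, OF \<theta>, folded A_def f_def g_def]
    show ?thesis
      unfolding split lhs design_entry.simps rhs using sums rhs1 by simp
  qed
  have solve: "s * (f \<theta> * g \<theta>) = 1 \<and> s * ((\<theta> $ c - 1 / \<theta> $ c) * g \<theta>) = of_real (b c)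
        \<and> (\<forall>j. j \<noteq> c \<longrightarrow> s * (f \<theta> * (\<theta> $ j - 1 / \<theta> $ j)) = of_real (b j))
      \<longleftrightarrow> s = 1 / (f \<theta> * g \<theta>) \<and> \<theta> \<in> T"
    if \<theta>: "\<And>i. \<theta> $ i \<noteq> 0" for s \<theta>
  proof
    assume L: "s * (f \<theta> * g \<theta>) = 1 \<and> s * ((\<theta> $ c - 1 / \<theta> $ c) * g \<theta>) = of_real (b c)
        \<and> (\<forall>j. j \<noteq> c \<longrightarrow> s * (f \<theta> * (\<theta> $ j - 1 / \<theta> $ j)) = of_real (b j))"
    then have "f \<theta> \<noteq> 0" "g \<theta> \<noteq> 0" by auto
    then have s: "s = 1 / (f \<theta> * g \<theta>)" using L by (simp add: eq_divide_eq)
    have "\<theta> $ c - 1 / \<theta> $ c = of_real (b c) * f \<theta>"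
      using L[THEN conjunct2, THEN conjunct1, symmetric] \<open>f \<theta> \<noteq> 0\<close> \<open>g \<theta> \<noteq> 0\<close> by (simp add: s)
    moreover have "\<theta> $ j - 1 / \<theta> $ j = of_real (b j) * g \<theta>" if "j \<noteq> c" for j
    proof -
      have "of_real (b j) = s * (f \<theta> * (\<theta> $ j - 1 / \<theta> $ j))" using L that by simp
      then show ?thesis using \<open>f \<theta> \<noteq> 0\<close> \<open>g \<theta> \<noteq> 0\<close> by (simp add: s)
    qed
    ultimately show "s = 1 / (f \<theta> * g \<theta>) \<and> \<theta> \<in> T"
      using s \<theta> by (simp add: T_def cross_critical_def f_def g_def)
  next
    assume R: "s = 1 / (f \<theta> * g \<theta>) \<and> \<theta> \<in> T"
    then have "f \<theta> \<noteq> 0" "g \<theta> \<noteq> 0"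
      by (auto simp: T_def f_def g_def dest: cross_critical_value_nonzero)
    moreover have "\<theta> $ c - 1 / \<theta> $ c = of_real (b c) * f \<theta>"
      "\<forall>j. j \<noteq> c \<longrightarrow> \<theta> $ j - 1 / \<theta> $ j = of_real (b j) * g \<theta>"
      using R by (auto simp: T_def cross_critical_def f_def g_def)
    ultimately show "s * (f \<theta> * g \<theta>) = 1 \<and> s * ((\<theta> $ c - 1 / \<theta> $ c) * g \<theta>) = of_real (b c)
        \<and> (\<forall>j. j \<noteq> c \<longrightarrow> s * (f \<theta> * (\<theta> $ j - 1 / \<theta> $ j)) = of_real (b j))"
      using R by simp
  qed
  have T: "\<theta> $ i \<noteq> 0" "f \<theta> * g \<theta> \<noteq> 0" if "\<theta> \<in> T" for \<theta> i
  proof -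
    show "\<theta> $ i \<noteq> 0" using that by (cases "i = c") (auto simp: T_def cross_critical_def)
    show "f \<theta> * g \<theta> \<noteq> 0"
      using that by (auto simp: T_def f_def g_def dest: cross_critical_value_nonzero)
  qed
  have solutions: "score_solutions A (toric_variety A) u = (\<lambda>\<theta>. toric_param A (1 / (f \<theta> * g \<theta>)) \<theta>) ` T"
  proof (intro equalityI subsetI)
    fix p assume p: "p \<in> score_solutions A (toric_variety A) u"
    then have "p \<in> toric_variety A" "\<And>a. a \<in> A \<Longrightarrow> p a \<noteq> 0" by (auto simp: score_solutions_def)
    then obtain s \<theta> where \<theta>: "\<And>i. \<theta> $ i \<noteq> 0" and p_eq: "p = toric_param A s \<theta>"
      using prism_torus_points[of p c, folded A_def] by metis
    have "\<forall>r. (\<Sum>a\<in>A. of_int (design_entry r a) * toric_param A s \<theta> a)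
        = 1 / of_nat N * (\<Sum>a\<in>A. of_int (design_entry r a) * of_nat (u a))"
      using p unfolding score_solutions_def p_eq N_def by blast
    then have "s = 1 / (f \<theta> * g \<theta>) \<and> \<theta> \<in> T"
      using score[OF \<theta>, of s] solve[OF \<theta>, of s] by blast
    then show "p \<in> (\<lambda>\<theta>. toric_param A (1 / (f \<theta> * g \<theta>)) \<theta>) ` T" using p_eq by blast
  next
    fix p assume "p \<in> (\<lambda>\<theta>. toric_param A (1 / (f \<theta> * g \<theta>)) \<theta>) ` T"
    then obtain \<theta> where \<theta>: "\<theta> \<in> T" and p: "p = toric_param A (1 / (f \<theta> * g \<theta>)) \<theta>" by blast
    have nz: "1 / (f \<theta> * g \<theta>) \<noteq> 0" "\<And>i. \<theta> $ i \<noteq> 0" using T[OF \<theta>] by auto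
    have "p \<in> toric_variety A" unfolding p by (rule toric_param_in_toric_variety[OF nz])
    moreover have "p a \<noteq> 0" if "a \<in> A" for a
      using that nz by (simp add: p toric_param_def)
    ultimately show "p \<in> score_solutions A (toric_variety A) u"
      using solve[OF nz(2), of "1 / (f \<theta> * g \<theta>)"] score[OF nz(2), of "1 / (f \<theta> * g \<theta>)"] \<theta>
      unfolding score_solutions_def p N_def[symmetric] by blast
  qed
  have "inj_on (\<lambda>\<theta>. toric_param A (1 / (f \<theta> * g \<theta>)) \<theta>) T"
  proof (rule inj_onI)
    fix \<theta> \<theta>' assume "\<theta> \<in> T" and
      "toric_param A (1 / (f \<theta> * g \<theta>)) \<theta> = toric_param A (1 / (f \<theta>' * g \<theta>')) \<theta>'"
    then show "\<theta> = \<theta>'" using toric_param_eq_prismD(2) T(2) unfolding A_def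
      by (metis divide_eq_0_iff zero_neq_one)
  qed
  then show "finite (score_solutions A (toric_variety A) u)
      \<and> card (score_solutions A (toric_variety A) u) = 2 ^ CARD('d)"
    unfolding solutions using card_cross_critical_pair[OF b, folded T_def] by (simp add: card_image)
qed

theorem proposition8p5:
  fixes d :: nat and c :: "'d::finite"
  assumes "CARD('d) = d" and "d \<ge> 2"
  shows "polytope_degree (graph_polytope (star_edges c)) = d * 2 ^ d
    \<and> polytope_ml_degree (graph_polytope (star_edges c)) = 2 ^ d"
  using assms(1) cone_degree_prism[of c] ml_degree_prism[of c]
  by (simp only: polytope_degree_def polytope_ml_degree_def lattice_points_star_polytope simp_thms)

end
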